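(* Assume that the energy and dissipation quantities satisfy, for some $c_E>0$, all $\mathcal V_h$-valued sequences $V$ and all $n_0\le n\le N$, $$c_E\|T_\delta V^n\|_\Omega^2\le e_\tau^n(V),\qquad c_E\,\delta\|A_\tau V^n\|_\Omega^2\le d_\tau^n(V),$$ that $0<\delta\le1$, that the approximation estimate $$\|Y-\Pi_hY\|_\Omega+h\|G(Y-\Pi_hY)\|_\Omega\lesssim h^r\|Y\|_{H^r(\Omega)}$$ holds for $Y=U(t)$, $\partial_tU(t)$ and $\partial_t^2U(t)$, and that the differentiated consistency bounds $$\max_{n_0\le n\le N}\|\rho^n\|_\Omega\lesssim\tau^\nu\mathcal C^\sharp_{T,\nu+2}(U,F),\qquad \|D_\tau^+\rho\|_{\ell_\tau^2(n_0,N-1;\mathcal H)}\lesssim\tau^\nu\mathcal C^\sharp_{T,\nu+2}(U,F)$$ hold. Then, with $\eta^n=U(t^n)-\Pi_hU(t^n)$, $$\|A_\tau\eta-\rho\|_{\mathcal E^*,N}\lesssim\bigl((1+T^{1/2})\delta^{1/2}h^{r-1}+\delta^{-1/2}h^r\bigr)\mathcal N_{r,2}(U)+(1+T^{1/2})\tau^\nu\,\mathcal C^\sharp_{T,\nu+2}(U,F).$$ The hidden constant depends on the fixed time stencil and on the coercivity constants, but not on $h$, $\tau$ or $\delta$.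
   Context: Setting. $\Omega\subset\mathbb R^d$ is a Lipschitz domain, $\mathcal H=[L^2(\Omega)]^{n_{\rm sys}}$ with inner product $(\cdot,\cdot)_\Omega$ and norm $\|\cdot\|_\Omega$; $\mathcal V\subset[H^1(\Omega)]^{n_{\rm sys}}$ is dense in $\mathcal H$; $G:\mathcal V\to\mathcal H$ is a time-independent linear first-order differential operator with $(GU,V)_\Omega=-(U,GV)_\Omega$ for all $U,V\in\mathcal V$. $U$ is the exact solution of $\partial_tU+GU=F$ on $(0,T)$, $U(0)=U_0$, assumed regular enough that all quantities below are defined. $\mathcal V_h\subset\mathcal V$ is a conforming finite element space of componentwise polynomial degree at most $k$ on a shape-regular mesh of mesh size $h$; $\Pi_h:\mathcal H\to\mathcal V_h$ is the $L^2$-orthogonal projection; $s\ge1$ is the spatial Sobolev regularity index and $r=\min(s,k+1)$. Time discretisation. $\tau>0$, $t^n=n\tau$ ($0\le n\le N$), $t^N\le T$, $\delta>0$. For sequences and fixed real coefficients $b_0,\dots,b_\ell$: $D_\tau^-V^n=\tau^{-1}(V^n-V^{n-1})$, $D_\tau^+V^n=\tau^{-1}(V^{n+1}-V^n)$, $\mathcal M_\tau V^n=\sum_{j=0}^\ell b_jV^{n-j}$ (the same notation is used for sampled functions). The first computed index $n_0$ satisfies $n_0\ge\ell$, $1\le n_0\le N$. Operators: $T_\delta=\mathrm{Id}+\delta G$, $S_\delta=\mathcal M_\tau+\delta D_\tau^-$, $A_\tau=D_\tau^-+G\mathcal M_\tau$, $P_\delta=T_\delta S_\delta$. The local truncation residual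 is $$\rho^n=D_\tau^-U(t^n)+G\mathcal M_\tau U(t^n)-\mathcal M_\tau F(t^n).$$ The method has temporal order $\nu$: it is a standing assumption that $\|\rho\|_{\ell_\tau^2(n_0,N;\mathcal H)}\lesssim\tau^\nu\mathcal C_{T,\nu+1}(U,F)$, where $\mathcal C_{T,\nu+1}(U,F)$ is an $L^2$-in-time regularity quantity; $\mathcal C^\sharp_{T,\nu+2}(U,F)\ge \mathcal C_{T,\nu+1}(U,F)$ is a regularity quantity containing one additional time derivative and endpoint regularity. Norms. $e_\tau^n(V),d_\tau^n(V)\ge0$ ($n_0\le n\le N$) are given method-dependent energy and dissipation quantities depending on $V^j$, $j\le n$. For $n_0\le m\le N$: $\|V\|_{\mathcal E,m}^2=\max_{n_0\le j\le m}e_\tau^j(V)+\tau\sum_{n=n_0}^md_\tau^n(V)$; $\mathcal I_\tau(V)=\sum_{j=0}^{n_0-1}\|T_\delta V^j\|_\Omega^2$; $\|R\|_{\ell_\tau^2(a,b;\mathcal H)}^2=\tau\sum_{n=a}^b\|R^n\|_\Omega^2$; and $$\|R\|_{\mathcal E^*,N}=\max_{n_0\le m\le N}\ \sup_{V}\ \frac{\tau\sum_{n=n_0}^m(R^n,P_\delta V^n)_\Omega}{\bigl(\mathcal I_\tau(V)+\|V\|_{\mathcal E,m}^2\bigr)^{1/2}},$$ the supremum being over $\mathcal V_h$-valued sequences with $V^n=0$ for $n\notin\{0,\dots,m\}$ and positive denominator. Finally $$\mathcal N_{r,2}(U)=\sum_{j=0}^2\|\partial_t^jU\|_{L^2(0,T;H^r(\Omega))}+\sum_{j=0}^1\|\partial_t^jU\|_{L^\infty(0,T;H^r(\Omega))}.$$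 Convention: $a\lesssim b$ means $a\le Cb$ with $C>0$ independent of the mesh size $h$, the time step $\tau$ and the final index $N$. *)

theory Defs
  imports "HOL-Analysis.Analysis" "HOL-Probability.Essential_Supremum"
begin

section \<open>The Hilbert space of square-integrable systems\<close>

definition square_integrable :: "(real^'d \<Rightarrow> real^'m) \<Rightarrow> bool" where
  "square_integrable f \<longleftrightarrow>
     f \<in> borel_measurable lebesgue \<and> integrable lebesgue (\<lambda>x. (norm (f x))\<^sup>2)"

definition L2_rel :: "(real^'d \<Rightarrow> real^'m) \<Rightarrow> (real^'d \<Rightarrow> real^'m) \<Rightarrow> bool" where
  "L2_rel f g \<longleftrightarrow> square_integrable f \<and> square_integrable g \<and> (AE x in lebesgue. f x = g x)"

lemma square_integrable_zero: "square_integrable (\<lambda>x. 0)"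
  by (simp add: square_integrable_def)

lemma square_integrable_scaleR:
  "square_integrable f \<Longrightarrow> square_integrable (\<lambda>x. c *\<^sub>R f x)"
  by (auto simp: square_integrable_def power_mult_distrib)

lemma square_integrable_add:
  assumes f: "square_integrable f" and g: "square_integrable g"
  shows "square_integrable (\<lambda>x. f x + g x)"
proof -
  have m: "f \<in> borel_measurable lebesgue" "g \<in> borel_measurable lebesgue"
    using f g by (auto simp: square_integrable_def)
  have "integrable lebesgue (\<lambda>x. 2 * (norm (f x))\<^sup>2 + 2 * (norm (g x))\<^sup>2)"
    using f g by (auto simp: square_integrable_def)
  then have "integrable lebesgue (\<lambda>x. (norm (f x + g x))\<^sup>2)"
  proof (rule Bochner_Integration.integrable_bound)
    show "(\<lambda>x. (norm (f x + g x))\<^sup>2) \<in> borel_measurable lebesgue"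
      using m by measurable
    have "(norm (f x + g x))\<^sup>2 \<le> 2 * (norm (f x))\<^sup>2 + 2 * (norm (g x))\<^sup>2" for x
    proof -
      have "(norm (f x + g x))\<^sup>2 \<le> (norm (f x) + norm (g x))\<^sup>2"
        by (intro power_mono norm_triangle_ineq) auto
      also have "\<dots> \<le> 2 * (norm (f x))\<^sup>2 + 2 * (norm (g x))\<^sup>2"
        using sum_squares_bound[of "norm (f x)" "norm (g x)"] by (simp add: power2_sum)
      finally show ?thesis .
    qed
    then show "AE x in lebesgue. norm ((norm (f x + g x))\<^sup>2)
        \<le> norm (2 * (norm (f x))\<^sup>2 + 2 * (norm (g x))\<^sup>2)"
      by (intro AE_I2) (simp add: abs_of_nonneg)
  qed
  with m show ?thesis by (auto simp: square_integrable_def)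
qed

lemma square_integrable_inner:
  assumes f: "square_integrable f" and g: "square_integrable g"
  shows "integrable lebesgue (\<lambda>x. f x \<bullet> g x)"
proof -
  have m: "f \<in> borel_measurable lebesgue" "g \<in> borel_measurable lebesgue"
    using f g by (auto simp: square_integrable_def)
  have "integrable lebesgue (\<lambda>x. (norm (f x))\<^sup>2 + (norm (g x))\<^sup>2)"
    using f g by (auto simp: square_integrable_def)
  then show ?thesis
  proof (rule Bochner_Integration.integrable_bound)
    show "(\<lambda>x. f x \<bullet> g x) \<in> borel_measurable lebesgue"
      using m by measurable
    have "\<bar>f x \<bullet> g x\<bar> \<le> (norm (f x))\<^sup>2 + (norm (g x))\<^sup>2" for x
    proof -
      have "\<bar>f x \<bullet> g x\<bar> \<le> norm (f x) * norm (g x)" by (rule Cauchy_Schwarz_ineq2)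
      also have "\<dots> \<le> 2 * norm (f x) * norm (g x)" by simp
      also have "\<dots> \<le> (norm (f x))\<^sup>2 + (norm (g x))\<^sup>2" by (rule sum_squares_bound)
      finally show ?thesis .
    qed
    then show "AE x in lebesgue. norm (f x \<bullet> g x) \<le> norm ((norm (f x))\<^sup>2 + (norm (g x))\<^sup>2)"
      by (intro AE_I2) (simp add: abs_of_nonneg)
  qed
qed

text \<open>\<open>('d, 'm) L2\<close> is the space of square-integrable functions on the whole of
  \<open>\<real>\<^sup>d\<close> with values in \<open>\<real>\<^sup>m\<close>, modulo equality almost everywhere.  The space over a
  domain \<open>\<Omega>\<close> is the subspace \<open>L2_on \<Omega>\<close> below, of classes vanishing almost everywhere
  outside \<open>\<Omega>\<close> (extension by zero is an isometry).\<close>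

quotient_type ('d, 'm) L2 = "real^'d \<Rightarrow> real^'m" / partial: L2_rel
proof (rule part_equivpI)
  show "\<exists>f::real^'d \<Rightarrow> real^'m. L2_rel f f"
    by (intro exI[of _ "\<lambda>x. 0"]) (simp add: L2_rel_def square_integrable_zero)
  show "symp (L2_rel :: (real^'d \<Rightarrow> real^'m) \<Rightarrow> _)"
    by (auto simp: symp_def L2_rel_def elim: eventually_mono)
  show "transp (L2_rel :: (real^'d \<Rightarrow> real^'m) \<Rightarrow> _)"
    unfolding transp_def L2_rel_def by (auto elim: eventually_elim2)
qed

instantiation L2 :: (finite, finite) real_vector
begin

lift_definition zero_L2 :: "('a, 'b) L2" is "\<lambda>x. 0"
  by (simp add: L2_rel_def square_integrable_zero)

lift_definition plus_L2 :: "('a, 'b) L2 \<Rightarrow> ('a, 'b) L2 \<Rightarrow> ('a, 'b) L2" is "\<lambda>f g x. f x + g x"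
  by (auto simp: L2_rel_def intro: square_integrable_add elim: eventually_elim2)

lift_definition scaleR_L2 :: "real \<Rightarrow> ('a, 'b) L2 \<Rightarrow> ('a, 'b) L2" is "\<lambda>c f x. c *\<^sub>R f x"
  by (auto simp: L2_rel_def intro: square_integrable_scaleR elim: eventually_mono)

lift_definition uminus_L2 :: "('a, 'b) L2 \<Rightarrow> ('a, 'b) L2" is "\<lambda>f x. - f x"
  using square_integrable_scaleR[where c = "-1"]
  by (auto simp: L2_rel_def elim: eventually_mono)

lift_definition minus_L2 :: "('a, 'b) L2 \<Rightarrow> ('a, 'b) L2 \<Rightarrow> ('a, 'b) L2" is "\<lambda>f g x. f x - g x"
proof -
  fix f f' g g' :: "real^'a \<Rightarrow> real^'b"
  assume *: "L2_rel f f'" "L2_rel g g'"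
  then have "square_integrable (\<lambda>x. f x + (-1) *\<^sub>R g x)" "square_integrable (\<lambda>x. f' x + (-1) *\<^sub>R g' x)"
    by (auto simp only: L2_rel_def intro!: square_integrable_add square_integrable_scaleR)
  with * show "L2_rel (\<lambda>x. f x - g x) (\<lambda>x. f' x - g' x)"
    by (auto simp: L2_rel_def elim: eventually_elim2)
qed

instance
proof
  fix u v w :: "('a, 'b) L2" and r s :: real
  show "u + v + w = u + (v + w)"
    by transfer (auto simp: L2_rel_def add.assoc intro!: square_integrable_add)
  show "u + v = v + u"
    by transfer (auto simp: L2_rel_def add.commute intro!: square_integrable_add)
  show "0 + u = u"
    by transfer (auto simp: L2_rel_def)
  show "- u + u = 0"
    by transfer (auto simp: L2_rel_def square_integrable_zero)
  show "u - v = u + - v"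
  proof transfer
    fix f g :: "real^'a \<Rightarrow> real^'b"
    assume "L2_rel f f" "L2_rel g g"
    then have "square_integrable (\<lambda>x. f x + (-1) *\<^sub>R g x)"
      by (auto simp only: L2_rel_def intro!: square_integrable_add square_integrable_scaleR)
    then show "L2_rel (\<lambda>x. f x - g x) (\<lambda>x. f x + - g x)"
      by (simp add: L2_rel_def)
  qed
  show "r *\<^sub>R (u + v) = r *\<^sub>R u + r *\<^sub>R v"
    by transfer (auto simp: L2_rel_def scaleR_add_right
        intro!: square_integrable_add square_integrable_scaleR)
  show "(r + s) *\<^sub>R u = r *\<^sub>R u + s *\<^sub>R u"
    by transfer (auto simp: L2_rel_def scaleR_add_left
        intro!: square_integrable_add square_integrable_scaleR)
  show "r *\<^sub>R s *\<^sub>R u = (r * s) *\<^sub>R u"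
    by transfer (auto simp: L2_rel_def intro!: square_integrable_scaleR)
  show "1 *\<^sub>R u = u"
    by transfer (auto simp: L2_rel_def)
qed

end

instantiation L2 :: (finite, finite) real_inner
begin

lift_definition inner_L2 :: "('a, 'b) L2 \<Rightarrow> ('a, 'b) L2 \<Rightarrow> real"
  is "\<lambda>f g. LINT x|lebesgue. f x \<bullet> g x"
proof -
  fix f f' g g' :: "real^'a \<Rightarrow> real^'b"
  assume "L2_rel f f'" "L2_rel g g'"
  then have *: "square_integrable f" "square_integrable f'" "square_integrable g"
      "square_integrable g'" "AE x in lebesgue. f x = f' x" "AE x in lebesgue. g x = g' x"
    by (auto simp: L2_rel_def)
  show "(LINT x|lebesgue. f x \<bullet> g x) = (LINT x|lebesgue. f' x \<bullet> g' x)"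
  proof (rule integral_cong_AE)
    show "(\<lambda>x. f x \<bullet> g x) \<in> borel_measurable lebesgue" "(\<lambda>x. f' x \<bullet> g' x) \<in> borel_measurable lebesgue"
      using * square_integrable_inner by (auto intro: borel_measurable_integrable)
    show "AE x in lebesgue. f x \<bullet> g x = f' x \<bullet> g' x"
      using *(5,6) by eventually_elim simp
  qed
qed

definition norm_L2 :: "('a, 'b) L2 \<Rightarrow> real" where "norm_L2 u = sqrt (inner u u)"
definition sgn_L2 :: "('a, 'b) L2 \<Rightarrow> ('a, 'b) L2" where "sgn_L2 u = u /\<^sub>R norm u"
definition dist_L2 :: "('a, 'b) L2 \<Rightarrow> ('a, 'b) L2 \<Rightarrow> real" where "dist_L2 u v = norm (u - v)"
definition uniformity_L2 :: "(('a, 'b) L2 \<times> ('a, 'b) L2) filter" where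
  "uniformity_L2 = (INF e\<in>{0<..}. principal {(x, y). dist x y < e})"
definition open_L2 :: "('a, 'b) L2 set \<Rightarrow> bool" where
  "open_L2 W = (\<forall>x\<in>W. \<forall>\<^sub>F (x', y) in uniformity. x' = x \<longrightarrow> y \<in> W)"

instance
proof
  fix u v w :: "('a, 'b) L2" and r :: real
  show "inner u v = inner v u"
    by transfer (auto simp: inner_commute)
  show "inner (u + v) w = inner u w + inner v w"
    by transfer (auto simp: L2_rel_def inner_add_left square_integrable_inner)
  show "inner (r *\<^sub>R u) v = r * inner u v"
    by transfer auto
  show "0 \<le> inner u u"
    by transfer auto
  show "inner u u = 0 \<longleftrightarrow> u = 0"
  proof transfer
    fix f :: "real^'a \<Rightarrow> real^'b" assume "L2_rel f f"
    then have sf: "square_integrable f" by (simp add: L2_rel_def)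
    have "(LINT x|lebesgue. f x \<bullet> f x) = 0 \<longleftrightarrow> (AE x in lebesgue. f x \<bullet> f x = 0)"
      by (intro integral_nonneg_eq_0_iff_AE square_integrable_inner sf) auto
    with sf show "(LINT x|lebesgue. f x \<bullet> f x) = 0 \<longleftrightarrow> L2_rel f (\<lambda>x. 0)"
      by (simp add: L2_rel_def square_integrable_zero)
  qed
qed (simp_all add: norm_L2_def sgn_L2_def dist_L2_def uniformity_L2_def open_L2_def)

end

definition L2_on :: "(real^'d) set \<Rightarrow> ('d, 'm::finite) L2 set" where
  "L2_on \<Omega> = {u. AE x in lebesgue. x \<notin> \<Omega> \<longrightarrow> rep_L2 u x = 0}"


section \<open>Lipschitz domains and Sobolev spaces\<close>

text \<open>Locally, up to a rotation, the domain is the strict epigraph of a Lipschitz function on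
  the hyperplane orthogonal to \<open>\<nu>\<close>.\<close>

definition lipschitz_domain :: "(real^'d) set \<Rightarrow> bool" where
  "lipschitz_domain \<Omega> \<longleftrightarrow> open \<Omega> \<and> connected \<Omega> \<and> bounded \<Omega> \<and> \<Omega> \<noteq> {} \<and>
     (\<forall>p\<in>frontier \<Omega>. \<exists>W \<nu> g L. open W \<and> p \<in> W \<and> norm \<nu> = 1 \<and>
        L-lipschitz_on {y. y \<bullet> \<nu> = 0} (g :: real^'d \<Rightarrow> real) \<and>
        \<Omega> \<inter> W = {x\<in>W. g (x - (x \<bullet> \<nu>) *\<^sub>R \<nu>) < x \<bullet> \<nu>})"

definition partial_deriv :: "'d \<Rightarrow> (real^'d \<Rightarrow> real) \<Rightarrow> real^'d \<Rightarrow> real" where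
  "partial_deriv i \<phi> x = frechet_derivative \<phi> (at x) (axis i 1)"

text \<open>Higher derivatives are indexed by lists of coordinate directions.\<close>

fun partial_derivs :: "'d list \<Rightarrow> (real^'d \<Rightarrow> real) \<Rightarrow> real^'d \<Rightarrow> real" where
  "partial_derivs [] \<phi> = \<phi>"
| "partial_derivs (i # ds) \<phi> = partial_deriv i (partial_derivs ds \<phi>)"

definition test_functions :: "(real^'d) set \<Rightarrow> (real^'d \<Rightarrow> real) set" where
  "test_functions \<Omega> = {\<phi>. (\<forall>ds x. partial_derivs ds \<phi> differentiable (at x)) \<and>
     (\<exists>K. compact K \<and> K \<subseteq> \<Omega> \<and> (\<forall>x. x \<notin> K \<longrightarrow> \<phi> x = 0))}"

definition has_weak_deriv ::
    "(real^'d) set \<Rightarrow> 'd list \<Rightarrow> ('d, 'm::finite) L2 \<Rightarrow> ('d, 'm) L2 \<Rightarrow> bool" where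
  "has_weak_deriv \<Omega> ds u g \<longleftrightarrow> g \<in> L2_on \<Omega> \<and>
     (\<forall>\<phi>\<in>test_functions \<Omega>.
        (LINT x:\<Omega>|lebesgue. partial_derivs ds \<phi> x *\<^sub>R rep_L2 u x) =
        (-1) ^ length ds *\<^sub>R (LINT x:\<Omega>|lebesgue. \<phi> x *\<^sub>R rep_L2 g x))"

definition weak_deriv :: "(real^'d) set \<Rightarrow> 'd list \<Rightarrow> ('d, 'm::finite) L2 \<Rightarrow> ('d, 'm) L2" where
  "weak_deriv \<Omega> ds u = (THE g. has_weak_deriv \<Omega> ds u g)"

definition gagliardo_sq :: "(real^'d) set \<Rightarrow> real \<Rightarrow> ('d, 'm::finite) L2 \<Rightarrow> ennreal" where
  "gagliardo_sq \<Omega> \<theta> u = (\<integral>\<^sup>+x\<in>\<Omega>. (\<integral>\<^sup>+y\<in>\<Omega>.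
     ennreal ((norm (rep_L2 u x - rep_L2 u y))\<^sup>2 / dist x y powr (real CARD('d) + 2 * \<theta>))
     \<partial>lebesgue) \<partial>lebesgue)"

text \<open>The Sobolev(-Slobodeckij) space of real order \<open>r \<ge> 0\<close>.  The sums over lists give
  the full (Frobenius) norms of the derivative tensors.\<close>

definition sobolev_space :: "(real^'d) set \<Rightarrow> real \<Rightarrow> ('d, 'm::finite) L2 set" where
  "sobolev_space \<Omega> r = {u\<in>L2_on \<Omega>.
     (\<forall>ds. length ds \<le> nat \<lfloor>r\<rfloor> \<longrightarrow> (\<exists>g. has_weak_deriv \<Omega> ds u g)) \<and>
     (frac r > 0 \<longrightarrow> (\<forall>ds. length ds = nat \<lfloor>r\<rfloor> \<longrightarrow>
        gagliardo_sq \<Omega> (frac r) (weak_deriv \<Omega> ds u) < \<infinity>))}"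

definition sobolev_norm :: "(real^'d) set \<Rightarrow> real \<Rightarrow> ('d, 'm::finite) L2 \<Rightarrow> real" where
  "sobolev_norm \<Omega> r u = sqrt
     ((\<Sum>ds | length ds \<le> nat \<lfloor>r\<rfloor>. (norm (weak_deriv \<Omega> ds u))\<^sup>2) +
      (if frac r > 0
       then \<Sum>ds | length ds = nat \<lfloor>r\<rfloor>. enn2real (gagliardo_sq \<Omega> (frac r) (weak_deriv \<Omega> ds u))
       else 0))"


section \<open>Functions of time with values in a Sobolev space\<close>

definition strongly_measurable ::
    "real \<Rightarrow> (real^'d) set \<Rightarrow> real \<Rightarrow> (real \<Rightarrow> ('d, 'm::finite) L2) \<Rightarrow> bool" where
  "strongly_measurable T \<Omega> r u \<longleftrightarrow>
     (\<exists>S::nat \<Rightarrow> real \<Rightarrow> ('d, 'm) L2.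
        (\<forall>n. finite (S n ` {0<..<T}) \<and> S n ` {0<..<T} \<subseteq> sobolev_space \<Omega> r \<and>
             (\<forall>y. {t\<in>{0<..<T}. S n t = y} \<in> sets lebesgue)) \<and>
        (AE t in lebesgue_on {0<..<T}. (\<lambda>n. sobolev_norm \<Omega> r (S n t - u t)) \<longlonglongrightarrow> 0))"

definition L2_time :: "real \<Rightarrow> (real^'d) set \<Rightarrow> real \<Rightarrow> (real \<Rightarrow> ('d, 'm::finite) L2) set" where
  "L2_time T \<Omega> r = {u. strongly_measurable T \<Omega> r u \<and>
     (AE t in lebesgue_on {0<..<T}. u t \<in> sobolev_space \<Omega> r) \<and>
     integrable (lebesgue_on {0<..<T}) (\<lambda>t. (sobolev_norm \<Omega> r (u t))\<^sup>2)}"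

definition L2_time_norm :: "real \<Rightarrow> (real^'d) set \<Rightarrow> real \<Rightarrow> (real \<Rightarrow> ('d, 'm::finite) L2) \<Rightarrow> real" where
  "L2_time_norm T \<Omega> r u = sqrt (LINT t|lebesgue_on {0<..<T}. (sobolev_norm \<Omega> r (u t))\<^sup>2)"

definition Linf_time :: "real \<Rightarrow> (real^'d) set \<Rightarrow> real \<Rightarrow> (real \<Rightarrow> ('d, 'm::finite) L2) set" where
  "Linf_time T \<Omega> r = {u. strongly_measurable T \<Omega> r u \<and>
     (AE t in lebesgue_on {0<..<T}. u t \<in> sobolev_space \<Omega> r) \<and>
     esssup (lebesgue_on {0<..<T}) (\<lambda>t. ereal (sobolev_norm \<Omega> r (u t))) < \<infinity>}"

definition Linf_time_norm :: "real \<Rightarrow> (real^'d) set \<Rightarrow> real \<Rightarrow> (real \<Rightarrow> ('d, 'm::finite) L2) \<Rightarrow> real" where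
  "Linf_time_norm T \<Omega> r u =
     real_of_ereal (esssup (lebesgue_on {0<..<T}) (\<lambda>t. ereal (sobolev_norm \<Omega> r (u t))))"

text \<open>\<open>u\<close> is a primitive of \<open>u'\<close> on \<open>[0,T]\<close>: the time derivative in the Sobolev (absolutely
  continuous) sense, \<open>u\<close> being the continuous representative.  A function that is continuous on
  \<open>[0,T]\<close> and classically differentiable on \<open>(0,T)\<close> satisfies this.\<close>

definition time_derivative ::
    "real \<Rightarrow> (real \<Rightarrow> 'a::real_normed_vector) \<Rightarrow> (real \<Rightarrow> 'a) \<Rightarrow> bool" where
  "time_derivative T u u' \<longleftrightarrow>
     (\<forall>a b. 0 \<le> a \<and> a \<le> b \<and> b \<le> T \<longrightarrow> (u' has_integral (u b - u a)) {a..b})"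


section \<open>The evolution problem\<close>

definition first_order_operator ::
    "(real^'d) set \<Rightarrow> ('d, 'm::finite) L2 set \<Rightarrow> (('d, 'm) L2 \<Rightarrow> ('d, 'm) L2) \<Rightarrow> bool" where
  "first_order_operator \<Omega> \<V> G \<longleftrightarrow>
     (\<forall>u\<in>\<V>. \<forall>v\<in>\<V>. \<forall>c. G (u + v) = G u + G v \<and> G (c *\<^sub>R u) = c *\<^sub>R G u) \<and>
     (\<exists>(A :: 'd \<Rightarrow> real^'d \<Rightarrow> real^'m^'m) (B :: real^'d \<Rightarrow> real^'m^'m).
        (\<forall>i. A i \<in> borel_measurable lebesgue) \<and> B \<in> borel_measurable lebesgue \<and>
        (\<forall>u\<in>\<V>. AE x in lebesgue_on \<Omega>.
           rep_L2 (G u) x = (\<Sum>i\<in>UNIV. A i x *v rep_L2 (weak_deriv \<Omega> [i] u) x) + B x *v rep_L2 u x))"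

text \<open>Boundary conditions are part of the choice of \<open>\<V>\<close>; outside \<open>\<V>\<close>, the values of \<open>G\<close> are
  irrelevant.\<close>

definition skew_system ::
    "(real^'d) set \<Rightarrow> ('d, 'm::finite) L2 set \<Rightarrow> (('d, 'm) L2 \<Rightarrow> ('d, 'm) L2) \<Rightarrow> bool" where
  "skew_system \<Omega> \<V> G \<longleftrightarrow> lipschitz_domain \<Omega> \<and>
     subspace \<V> \<and> \<V> \<subseteq> sobolev_space \<Omega> 1 \<and> L2_on \<Omega> \<subseteq> closure \<V> \<and>
     first_order_operator \<Omega> \<V> G \<and> G ` \<V> \<subseteq> L2_on \<Omega> \<and>
     (\<forall>u\<in>\<V>. \<forall>v\<in>\<V>. inner (G u) v = - inner u (G v))"

text \<open>\<open>U j\<close> is the \<open>j\<close>-th time derivative of the exact solution \<open>U 0\<close>.  Besides the equation,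
  this collects the regularity needed for the approximation estimates for \<open>U 0\<close>, \<open>U 1\<close>, \<open>U 2\<close>,
  for the residual, and for the quantity \<open>N_norm\<close> below to be meaningful.\<close>

definition exact_solution ::
    "(real^'d) set \<Rightarrow> ('d, 'm::finite) L2 set \<Rightarrow> (('d, 'm) L2 \<Rightarrow> ('d, 'm) L2) \<Rightarrow> real \<Rightarrow> real \<Rightarrow>
     (real \<Rightarrow> ('d, 'm) L2) \<Rightarrow> ('d, 'm) L2 \<Rightarrow> (nat \<Rightarrow> real \<Rightarrow> ('d, 'm) L2) \<Rightarrow> bool" where
  "exact_solution \<Omega> \<V> G T r F U0 U \<longleftrightarrow>
     (\<forall>t\<in>{0..T}. U 0 t \<in> \<V> \<and> F t \<in> L2_on \<Omega>) \<and>
     time_derivative T (U 0) (U 1) \<and> time_derivative T (U 1) (U 2) \<and>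
     (\<forall>j\<le>2. AE t in lebesgue_on {0<..<T}. U j t \<in> \<V>) \<and>
     (\<forall>j\<le>2. U j \<in> L2_time T \<Omega> r) \<and> (\<forall>j\<le>1. U j \<in> Linf_time T \<Omega> r) \<and>
     (\<forall>t\<in>{0<..<T}. U 1 t + G (U 0 t) = F t) \<and> U 0 0 = U0"

definition N_norm ::
    "real \<Rightarrow> (real^'d) set \<Rightarrow> real \<Rightarrow> (nat \<Rightarrow> real \<Rightarrow> ('d, 'm::finite) L2) \<Rightarrow> real" where
  "N_norm T \<Omega> r U =
     (\<Sum>j\<le>2. L2_time_norm T \<Omega> r (U j)) + (\<Sum>j\<le>1. Linf_time_norm T \<Omega> r (U j))"


section \<open>Finite element spaces\<close>

definition poly_deg_le :: "nat \<Rightarrow> (real^'d \<Rightarrow> real) \<Rightarrow> bool" where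
  "poly_deg_le k p \<longleftrightarrow> (\<exists>c :: ('d \<Rightarrow> nat) \<Rightarrow> real. \<forall>x.
     p x = (\<Sum>\<alpha> | (\<Sum>i\<in>UNIV. \<alpha> i) \<le> k. c \<alpha> * (\<Prod>i\<in>UNIV. (x $ i) ^ \<alpha> i)))"

text \<open>Cells are closures of Lipschitz domains, so that simplices, boxes and curved elements are
  all covered; \<open>\<sigma>\<close> is the shape-regularity constant.\<close>

definition shape_regular_mesh :: "real \<Rightarrow> (real^'d) set \<Rightarrow> real \<Rightarrow> (real^'d) set set \<Rightarrow> bool" where
  "shape_regular_mesh \<sigma> \<Omega> h \<T> \<longleftrightarrow> finite \<T> \<and> \<Union>\<T> = closure \<Omega> \<and>
     (\<forall>K\<in>\<T>. lipschitz_domain (interior K) \<and> closure (interior K) = K) \<and>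
     (\<forall>K\<in>\<T>. \<forall>K'\<in>\<T>. K \<noteq> K' \<longrightarrow> interior K \<inter> interior K' = {}) \<and>
     (\<forall>K\<in>\<T>. \<exists>x \<rho>. 0 < \<rho> \<and> ball x \<rho> \<subseteq> K \<and> diameter K \<le> \<sigma> * \<rho>) \<and>
     h = Max (diameter ` \<T>)"

definition fe_space ::
    "(real^'d) set \<Rightarrow> ('d, 'm::finite) L2 set \<Rightarrow> real \<Rightarrow> nat \<Rightarrow> real \<Rightarrow> ('d, 'm) L2 set \<Rightarrow> bool" where
  "fe_space \<Omega> \<V> \<sigma> k h Vh \<longleftrightarrow> (\<exists>\<T>. shape_regular_mesh \<sigma> \<Omega> h \<T> \<and>
     Vh \<subseteq> \<V> \<and> (\<exists>B. finite B \<and> Vh = span B) \<and>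
     (\<forall>v\<in>Vh. \<forall>K\<in>\<T>. \<forall>c. \<exists>p. poly_deg_le k p \<and>
        (AE x in lebesgue_on K. rep_L2 v x $ c = p x)))"

definition L2_projection :: "'a::real_inner set \<Rightarrow> 'a \<Rightarrow> 'a" where
  "L2_projection Vh Y = (THE p. p \<in> Vh \<and> (\<forall>v\<in>Vh. inner (Y - p) v = 0))"


section \<open>Time discretisation\<close>

text \<open>The bound \<open>\<tau>max\<close> on the step size enters the hidden constant; for fixed \<open>T\<close> it is no
  restriction, since \<open>\<tau> \<le> real N * \<tau> \<le> T\<close> when \<open>1 \<le> n0\<close>, so that one may take
  \<open>\<tau>max = T\<close>.  Without any bound on \<open>\<tau>\<close>, sampled \<open>\<ell>\<^sup>2\<close> norms are not controlled by the
  \<open>L\<^sup>2\<close>-in-time norms of a function and its derivative uniformly in \<open>T\<close>.\<close>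

definition time_grid :: "real \<Rightarrow> real \<Rightarrow> real \<Rightarrow> nat \<Rightarrow> nat \<Rightarrow> bool" where
  "time_grid \<tau>max T \<tau> n0 N \<longleftrightarrow> 0 < \<tau> \<and> \<tau> \<le> \<tau>max \<and> n0 \<le> N \<and> real N * \<tau> \<le> T"

definition D_minus :: "real \<Rightarrow> (nat \<Rightarrow> 'a::real_vector) \<Rightarrow> nat \<Rightarrow> 'a" where
  "D_minus \<tau> V n = (V n - V (n - 1)) /\<^sub>R \<tau>"

definition D_plus :: "real \<Rightarrow> (nat \<Rightarrow> 'a::real_vector) \<Rightarrow> nat \<Rightarrow> 'a" where
  "D_plus \<tau> V n = (V (n + 1) - V n) /\<^sub>R \<tau>"

text \<open>Only used for indices \<open>n \<ge> l\<close> (and \<open>n \<ge> 1\<close> for \<open>D_minus\<close>), so that the subtraction does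
  not truncate.\<close>

definition M_tau :: "(nat \<Rightarrow> real) \<Rightarrow> nat \<Rightarrow> (nat \<Rightarrow> 'a::real_vector) \<Rightarrow> nat \<Rightarrow> 'a" where
  "M_tau b l V n = (\<Sum>j\<le>l. b j *\<^sub>R V (n - j))"

definition T_delta :: "('a::real_vector \<Rightarrow> 'a) \<Rightarrow> real \<Rightarrow> 'a \<Rightarrow> 'a" where
  "T_delta G \<delta> v = v + \<delta> *\<^sub>R G v"

definition S_delta ::
    "(nat \<Rightarrow> real) \<Rightarrow> nat \<Rightarrow> real \<Rightarrow> real \<Rightarrow> (nat \<Rightarrow> 'a::real_vector) \<Rightarrow> nat \<Rightarrow> 'a" where
  "S_delta b l \<tau> \<delta> V n = M_tau b l V n + \<delta> *\<^sub>R D_minus \<tau> V n"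

definition A_tau ::
    "('a::real_vector \<Rightarrow> 'a) \<Rightarrow> (nat \<Rightarrow> real) \<Rightarrow> nat \<Rightarrow> real \<Rightarrow> (nat \<Rightarrow> 'a) \<Rightarrow> nat \<Rightarrow> 'a" where
  "A_tau G b l \<tau> V n = D_minus \<tau> V n + G (M_tau b l V n)"

definition P_delta ::
    "('a::real_vector \<Rightarrow> 'a) \<Rightarrow> (nat \<Rightarrow> real) \<Rightarrow> nat \<Rightarrow> real \<Rightarrow> real \<Rightarrow> (nat \<Rightarrow> 'a) \<Rightarrow> nat \<Rightarrow> 'a" where
  "P_delta G b l \<tau> \<delta> V n = T_delta G \<delta> (S_delta b l \<tau> \<delta> V n)"

definition residual ::
    "('a::real_vector \<Rightarrow> 'a) \<Rightarrow> (nat \<Rightarrow> real) \<Rightarrow> nat \<Rightarrow> real \<Rightarrow> (real \<Rightarrow> 'a) \<Rightarrow> (real \<Rightarrow> 'a) \<Rightarrow> nat \<Rightarrow> 'a" where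
  "residual G b l \<tau> U F n =
     D_minus \<tau> (\<lambda>i. U (real i * \<tau>)) n + G (M_tau b l (\<lambda>i. U (real i * \<tau>)) n)
     - M_tau b l (\<lambda>i. F (real i * \<tau>)) n"

definition ell2_norm :: "real \<Rightarrow> nat \<Rightarrow> nat \<Rightarrow> (nat \<Rightarrow> 'a::real_normed_vector) \<Rightarrow> real" where
  "ell2_norm \<tau> i j R = sqrt (\<tau> * (\<Sum>n=i..j. (norm (R n))\<^sup>2))"

definition energy_norm_sq ::
    "real \<Rightarrow> nat \<Rightarrow> (nat \<Rightarrow> (nat \<Rightarrow> 'a) \<Rightarrow> real) \<Rightarrow> (nat \<Rightarrow> (nat \<Rightarrow> 'a) \<Rightarrow> real) \<Rightarrow> nat \<Rightarrow> (nat \<Rightarrow> 'a) \<Rightarrow> real" where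
  "energy_norm_sq \<tau> n0 e d m V = Max ((\<lambda>j. e j V) ` {n0..m}) + \<tau> * (\<Sum>n=n0..m. d n V)"

definition initial_energy ::
    "('a::real_normed_vector \<Rightarrow> 'a) \<Rightarrow> real \<Rightarrow> nat \<Rightarrow> (nat \<Rightarrow> 'a) \<Rightarrow> real" where
  "initial_energy G \<delta> n0 V = (\<Sum>j<n0. (norm (T_delta G \<delta> (V j)))\<^sup>2)"

text \<open>The supremum is taken in the extended reals, so that an upper bound for it also asserts
  that it is not \<open>\<infinity>\<close>.\<close>

definition dual_norm ::
    "'a::real_inner set \<Rightarrow> ('a \<Rightarrow> 'a) \<Rightarrow> (nat \<Rightarrow> real) \<Rightarrow> nat \<Rightarrow> real \<Rightarrow> real \<Rightarrow> nat \<Rightarrow> nat \<Rightarrow>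
     (nat \<Rightarrow> (nat \<Rightarrow> 'a) \<Rightarrow> real) \<Rightarrow> (nat \<Rightarrow> (nat \<Rightarrow> 'a) \<Rightarrow> real) \<Rightarrow> (nat \<Rightarrow> 'a) \<Rightarrow> ereal" where
  "dual_norm Vh G b l \<tau> \<delta> n0 N e d R =
     Max ((\<lambda>m. SUP V \<in> {V. range V \<subseteq> Vh \<and> (\<forall>n>m. V n = 0) \<and>
                          0 < initial_energy G \<delta> n0 V + energy_norm_sq \<tau> n0 e d m V}.
             ereal ((\<tau> * (\<Sum>n=n0..m. inner (R n) (P_delta G b l \<tau> \<delta> V n))) /
                    sqrt (initial_energy G \<delta> n0 V + energy_norm_sq \<tau> n0 e d m V))) ` {n0..N})"

text \<open>Energy and dissipation quantities: nonnegative, causal (the value at step \<open>n\<close> depends on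
  the entries with index at most \<open>n\<close> only), and coercive with constant \<open>cE\<close>.\<close>

definition coercive_energy ::
    "'a::real_inner set \<Rightarrow> ('a \<Rightarrow> 'a) \<Rightarrow> (nat \<Rightarrow> real) \<Rightarrow> nat \<Rightarrow> real \<Rightarrow> real \<Rightarrow> nat \<Rightarrow> nat \<Rightarrow> real \<Rightarrow>
     (nat \<Rightarrow> (nat \<Rightarrow> 'a) \<Rightarrow> real) \<Rightarrow> (nat \<Rightarrow> (nat \<Rightarrow> 'a) \<Rightarrow> real) \<Rightarrow> bool" where
  "coercive_energy Vh G b l \<tau> \<delta> n0 N cE e d \<longleftrightarrow>
     (\<forall>V n. range V \<subseteq> Vh \<and> n \<in> {n0..N} \<longrightarrow>
        0 \<le> e n V \<and> 0 \<le> d n V \<and>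
        (\<forall>W. range W \<subseteq> Vh \<and> (\<forall>j\<le>n. W j = V j) \<longrightarrow> e n W = e n V \<and> d n W = d n V) \<and>
        cE * (norm (T_delta G \<delta> (V n)))\<^sup>2 \<le> e n V \<and>
        cE * \<delta> * (norm (A_tau G b l \<tau> V n))\<^sup>2 \<le> d n V)"

definition approximation_estimate ::
    "'a::real_inner set \<Rightarrow> ('a \<Rightarrow> 'a) \<Rightarrow> real \<Rightarrow> real \<Rightarrow> real \<Rightarrow> ('a \<Rightarrow> real) \<Rightarrow> 'a \<Rightarrow> bool" where
  "approximation_estimate Vh G c h r nrm Y \<longleftrightarrow>
     norm (Y - L2_projection Vh Y) + h * norm (G (Y - L2_projection Vh Y)) \<le> c * h powr r * nrm Y"

end

theory Submission
  imports Defs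
begin

text \<open>
Write \<open>y = \<eta>\<close> for the projection error on the time grid, \<open>x = G \<eta>\<close>, and, for a test sequence \<open>V\<close>
with values in \<open>V\<^sub>h\<close>, \<open>g = G V\<close>, \<open>t = T\<^sub>\<delta> V\<close> and \<open>a = A\<^sub>\<tau> V = D\<^sup>- V + M g\<close>.  Coercivity gives just
two pieces of information on \<open>V\<close>: the maximum of \<open>\<parallel>t\<parallel>\<close> and the sampled norm of \<open>\<surd>\<delta> a\<close> are
bounded by the energy norm in the denominator of the dual norm.  Skew-symmetry makes \<open>V\<close> and
\<open>\<delta> G V\<close> orthogonal, so that \<open>\<parallel>V\<parallel>\<close> and \<open>\<delta> \<parallel>g\<parallel>\<close> are at most \<open>\<parallel>t\<parallel>\<close>.  The proof consists in arranging
the pairing with \<open>P\<^sub>\<delta> V\<close> such that only these quantities occur.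

For the residual the right form is \<open>P\<^sub>\<delta> V = M t + \<delta> D\<^sup>- t\<close>: in the second term summation by parts
moves the difference quotient to \<open>\<rho>\<close>, where the bound on \<open>D\<^sup>+ \<rho>\<close> applies.

For the projection error the right form is \<open>P\<^sub>\<delta> V = M V + \<delta> a + \<delta>\<^sup>2 D\<^sup>- g\<close>.  As \<open>y\<close> is orthogonal to
\<open>V\<^sub>h\<close> and \<open>G\<close> is skew-symmetric, the pairing of \<open>D\<^sup>- y + M x\<close> with it becomes
\<open>\<delta> (D\<^sup>- y, a) - \<delta>\<^sup>2 (D\<^sup>- x, D\<^sup>- V) - (M y, a) + \<delta> (M x, a) + \<delta>\<^sup>2 (M x, D\<^sup>- g)\<close>
(\<open>projection_error_pairing\<close>).  The terms with \<open>a\<close> are estimated by Cauchy-Schwarz; the factor \<open>M y\<close>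
is of size \<open>h\<^sup>r\<close> and produces \<open>\<delta>\<close> to the power \<open>-1/2\<close>.  In the other two terms summation by parts
moves a difference quotient to \<open>x\<close>, which is of size \<open>h\<close> to the power \<open>r - 1\<close>.  No term combines
\<open>\<surd>T\<close> with \<open>h\<^sup>r\<close>, so that the estimate is uniform in \<open>h\<close> even when \<open>h\<close> is large.

It remains to bound \<open>x\<close>, \<open>y\<close> and their first and second differences, pointwise and in the sampled
norm, by the norms in time of \<open>\<partial>\<^sub>t\<^sup>j U\<close>.  The approximation estimate holds for almost
every time only, and \<open>G\<close> is not continuous, so that it cannot be exchanged with the integrals that
express \<open>U\<close> by its time derivatives.  Both difficulties disappear when everything is tested: for \<open>w\<close> in the dense space \<open>\<V>\<close>,
\<open>(G (U - \<Pi> U), w)\<close> is the pairing of \<open>U\<close> with a fixed vector depending on \<open>w\<close> only, hence a scalar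
function of time which can be differentiated together with \<open>U\<close> and which is bounded almost
everywhere, like its derivatives, by \<open>\<parallel>w\<parallel>\<close> times an \<open>H\<^sup>r\<close> norm (\<open>dominated_samples\<close>).  The
fundamental theorem of calculus for scalar functions and Cauchy-Schwarz on every grid cell then give
all bounds.
\<close>

section \<open>Sums over the time grid\<close>

lemma ell2_norm_L2_set:
  "ell2_norm \<tau> i j R = sqrt \<tau> * L2_set (\<lambda>n. norm (R n)) {i..j}"
  by (simp add: ell2_norm_def L2_set_def real_sqrt_mult)

lemma ell2_norm_nonneg: "0 \<le> \<tau> \<Longrightarrow> 0 \<le> ell2_norm \<tau> i j R"
  by (simp add: ell2_norm_def sum_nonneg)

lemma ell2_norm_mono_range:
  assumes "0 \<le> \<tau>" "{i..j} \<subseteq> {i'..j'}"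
  shows "ell2_norm \<tau> i j R \<le> ell2_norm \<tau> i' j' R"
  unfolding ell2_norm_def
  by (intro real_sqrt_le_mono mult_left_mono sum_mono2 assms) auto

lemma inner_sum_le_ell2_norm:
  assumes "0 \<le> \<tau>"
  shows "\<bar>\<tau> * (\<Sum>n=i..j. inner (R n) (S n))\<bar> \<le> ell2_norm \<tau> i j R * ell2_norm \<tau> i j S"
proof -
  have "\<bar>\<Sum>n=i..j. inner (R n) (S n)\<bar> \<le> (\<Sum>n=i..j. \<bar>norm (R n)\<bar> * \<bar>norm (S n)\<bar>)"
    by (rule order_trans[OF sum_abs]) (auto intro!: sum_mono Cauchy_Schwarz_ineq2)
  also have "\<dots> \<le> L2_set (\<lambda>n. norm (R n)) {i..j} * L2_set (\<lambda>n. norm (S n)) {i..j}"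
    by (rule L2_set_mult_ineq)
  finally have "\<tau> * \<bar>\<Sum>n=i..j. inner (R n) (S n)\<bar>
      \<le> \<tau> * (L2_set (\<lambda>n. norm (R n)) {i..j} * L2_set (\<lambda>n. norm (S n)) {i..j})"
    using assms by (rule mult_left_mono)
  also have "\<dots> = ell2_norm \<tau> i j R * ell2_norm \<tau> i j S"
    using assms by (simp add: ell2_norm_L2_set algebra_simps flip: real_sqrt_mult)
  finally show ?thesis
    using assms by (simp add: abs_mult)
qed

lemma sum_constant_step_le:
  assumes "0 \<le> \<tau>" "1 \<le> i" "real N * \<tau> \<le> T" "j \<le> N"
  shows "\<tau> * real (card {i..j}) \<le> T"
proof -
  have "\<tau> * real (card {i..j}) \<le> \<tau> * real N"
    using assms by (intro mult_left_mono) auto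
  then show ?thesis
    using assms(3) by (simp add: mult.commute)
qed

text \<open>Cauchy-Schwarz in time; since the index \<open>0\<close> is excluded, the steps \<open>i, \<dots>, j\<close> cover a length of at
most \<open>T\<close>.\<close>

lemma norm_sum_le_ell2_norm:
  assumes "0 \<le> \<tau>" "1 \<le> i" "real N * \<tau> \<le> T" "j \<le> N"
  shows "\<tau> * (\<Sum>n=i..j. norm (R n)) \<le> sqrt T * ell2_norm \<tau> i j R"
proof -
  have "\<tau> * (\<Sum>n=i..j. norm (R n)) = \<bar>\<tau> * (\<Sum>n=i..j. inner (norm (R n)) 1)\<bar>"
    using assms(1) by (simp add: sum_nonneg)
  also have "\<dots> \<le> ell2_norm \<tau> i j (\<lambda>n. norm (R n)) * ell2_norm \<tau> i j (\<lambda>n. 1::real)"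
    using assms(1) by (rule inner_sum_le_ell2_norm)
  also have "\<dots> \<le> ell2_norm \<tau> i j R * sqrt T"
  proof (intro mult_mono ell2_norm_nonneg assms)
    show "ell2_norm \<tau> i j (\<lambda>n. 1::real) \<le> sqrt T"
      using sum_constant_step_le[OF assms] by (simp add: ell2_norm_def)
  qed (simp add: ell2_norm_def)
  finally show ?thesis by (simp add: mult.commute)
qed

lemma ell2_norm_le_sup:
  assumes "0 \<le> \<tau>" "1 \<le> i" "real N * \<tau> \<le> T" "j \<le> N" "0 \<le> K"
    and R: "\<And>n. i \<le> n \<Longrightarrow> n \<le> j \<Longrightarrow> norm (R n) \<le> K"
  shows "ell2_norm \<tau> i j R \<le> sqrt T * K"
proof -
  have "\<tau> * (\<Sum>n=i..j. (norm (R n))\<^sup>2) \<le> \<tau> * (\<Sum>n=i..j. K\<^sup>2)"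
    by (intro mult_left_mono sum_mono power_mono R assms) auto
  also have "\<dots> = (\<tau> * real (card {i..j})) * K\<^sup>2"
    by simp
  also have "\<dots> \<le> T * K\<^sup>2"
    by (intro mult_right_mono sum_constant_step_le[OF assms(1-4)]) auto
  finally have "ell2_norm \<tau> i j R \<le> sqrt (T * K\<^sup>2)"
    unfolding ell2_norm_def by simp
  then show ?thesis
    using assms(5) by (simp add: real_sqrt_mult)
qed

text \<open>Moves the difference quotient off \<open>W\<close>, which afterwards enters through its maximum only; the price
is a difference of \<open>R\<close> and two boundary terms.\<close>

lemma summation_by_parts:
  fixes R W :: "nat \<Rightarrow> 'a::real_inner"
  assumes "1 \<le> i" "i \<le> m"
  shows "(\<Sum>n=i..m. inner (R n) (W n - W (n - 1))) =
    inner (R m) (W m) - inner (R i) (W (i - 1)) - (\<Sum>n=i..<m. inner (R (n + 1) - R n) (W n))"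
  using assms(2)
proof (induction m rule: dec_induct)
  case base
  then show ?case by (simp add: inner_diff_right)
next
  case (step m)
  then show ?case by (simp add: inner_diff_left inner_diff_right)
qed

lemma inner_D_minus_sum_le:
  fixes R W :: "nat \<Rightarrow> 'a::real_inner"
  assumes "0 < \<tau>" "1 \<le> i" "i \<le> m" "m \<le> N" "real N * \<tau> \<le> T" "0 \<le> K"
    and R: "\<And>n. i \<le> n \<Longrightarrow> n \<le> N \<Longrightarrow> norm (R n) \<le> K"
    and DR: "ell2_norm \<tau> i (N - 1) (D_plus \<tau> R) \<le> K"
    and W: "\<And>n. n \<le> m \<Longrightarrow> norm (W n) \<le> \<omega>"
  shows "\<bar>\<tau> * (\<Sum>n=i..m. inner (R n) (D_minus \<tau> W n))\<bar> \<le> 2 * (1 + sqrt T) * K * \<omega>"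
proof -
  have T: "0 \<le> T"
    using assms by (meson less_imp_le mult_nonneg_nonneg of_nat_0_le_iff order_trans)
  have \<omega>: "0 \<le> \<omega>"
    using W[of 0] norm_ge_zero order_trans by blast
  have end_le: "\<bar>inner (R n) (W n')\<bar> \<le> K * \<omega>" if "i \<le> n" "n \<le> m" "n' \<le> m" for n n'
    by (rule order_trans[OF Cauchy_Schwarz_ineq2]) (use that assms in \<open>auto intro!: mult_mono R W\<close>)
  have ivl: "{i..<m} = {i..m - 1}"
    using assms by auto
  have step: "norm (R (n + 1) - R n) = \<tau> * norm (D_plus \<tau> R n)" for n
    using assms(1) by (simp add: D_plus_def)
  have "\<bar>\<Sum>n=i..<m. inner (R (n + 1) - R n) (W n)\<bar> \<le> (\<Sum>n=i..<m. norm (R (n + 1) - R n) * \<omega>)"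
    by (rule order_trans[OF sum_abs])
       (auto intro!: sum_mono order_trans[OF Cauchy_Schwarz_ineq2] mult_left_mono W)
  also have "\<dots> = \<tau> * (\<Sum>n=i..m - 1. norm (D_plus \<tau> R n)) * \<omega>"
    using step ivl by (simp add: sum_distrib_left sum_distrib_right)
  also have "\<tau> * (\<Sum>n=i..m - 1. norm (D_plus \<tau> R n)) * \<omega> \<le> sqrt T * ell2_norm \<tau> i (m - 1) (D_plus \<tau> R) * \<omega>"
    using assms \<omega> by (intro mult_right_mono norm_sum_le_ell2_norm[where N = N]) auto
  also have "\<dots> \<le> sqrt T * K * \<omega>"
  proof -
    have "ell2_norm \<tau> i (m - 1) (D_plus \<tau> R) \<le> K"
      by (rule order_trans[OF ell2_norm_mono_range DR]) (use assms in auto)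
    then show ?thesis
      using T \<omega> by (intro mult_right_mono mult_left_mono) auto
  qed
  finally have inner_part: "\<bar>\<Sum>n=i..<m. inner (R (n + 1) - R n) (W n)\<bar> \<le> sqrt T * K * \<omega>" .
  have "\<tau> * (\<Sum>n=i..m. inner (R n) (D_minus \<tau> W n)) = (\<Sum>n=i..m. inner (R n) (W n - W (n - 1)))"
    using assms(1) by (simp add: D_minus_def sum_distrib_left flip: mult.assoc)
  also have "\<bar>\<dots>\<bar> \<le> K * \<omega> + K * \<omega> + sqrt T * K * \<omega>"
    unfolding summation_by_parts[OF assms(2,3)]
    using end_le[of m m] end_le[of i "i - 1"] inner_part assms(2,3)
    by (simp add: le_diff_conv)
  also have "\<dots> \<le> 2 * (1 + sqrt T) * K * \<omega>"
    using T \<omega> assms(6) by (simp add: algebra_simps)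
  finally show ?thesis .
qed

section \<open>The averaging stencil\<close>

lemma L2_set_sum_le:
  assumes "\<And>j. 0 \<le> c j"
  shows "L2_set (\<lambda>n. \<Sum>j\<le>l. c j * f j n) A \<le> (\<Sum>j\<le>(l::nat). c j * L2_set (f j) A)"
proof (induction l)
  case 0
  then show ?case using assms by (simp add: L2_set_right_distrib)
next
  case (Suc l)
  have "L2_set (\<lambda>n. \<Sum>j\<le>Suc l. c j * f j n) A
      \<le> L2_set (\<lambda>n. \<Sum>j\<le>l. c j * f j n) A + L2_set (\<lambda>n. c (Suc l) * f (Suc l) n) A"
    by (simp add: L2_set_triangle_ineq)
  also have "\<dots> \<le> (\<Sum>j\<le>l. c j * L2_set (f j) A) + c (Suc l) * L2_set (f (Suc l)) A"
    using Suc assms by (simp add: L2_set_right_distrib)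
  finally show ?case by simp
qed

lemma norm_M_tau_le: "norm (M_tau b l V n) \<le> (\<Sum>j\<le>l. \<bar>b j\<bar> * norm (V (n - j)))"
  unfolding M_tau_def by (rule order_trans[OF norm_sum]) simp

lemma norm_M_tau_le_sup:
  assumes "\<And>i. i \<le> n \<Longrightarrow> norm (V i) \<le> K"
  shows "norm (M_tau b l V n) \<le> (\<Sum>j\<le>l. \<bar>b j\<bar>) * K"
  unfolding sum_distrib_right
  by (rule order_trans[OF norm_M_tau_le]) (auto intro!: sum_mono mult_left_mono assms)

text \<open>The Minkowski inequality; every shift by \<open>j \<le> l \<le> i\<close> is injective on \<open>{i..m}\<close>, so that no sample is
counted twice.\<close>

lemma ell2_norm_M_tau_le:
  assumes "0 \<le> \<tau>" "l \<le> i"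
  shows "ell2_norm \<tau> i m (M_tau b l V) \<le> (\<Sum>j\<le>l. \<bar>b j\<bar>) * ell2_norm \<tau> 0 m V"
proof -
  have "L2_set (\<lambda>n. norm (M_tau b l V n)) {i..m}
      \<le> L2_set (\<lambda>n. \<Sum>j\<le>l. \<bar>b j\<bar> * norm (V (n - j))) {i..m}"
    by (intro L2_set_mono norm_M_tau_le) auto
  also have "\<dots> \<le> (\<Sum>j\<le>l. \<bar>b j\<bar> * L2_set (\<lambda>n. norm (V (n - j))) {i..m})"
    by (rule L2_set_sum_le) simp
  also have "\<dots> \<le> (\<Sum>j\<le>l. \<bar>b j\<bar> * L2_set (\<lambda>n. norm (V n)) {0..m})"
  proof (intro sum_mono mult_left_mono)
    fix j assume "j \<in> {..l}"
    then have inj: "inj_on (\<lambda>n. n - j) {i..m}"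
      using assms(2) by (auto simp: inj_on_def)
    have "(\<Sum>n=i..m. (norm (V (n - j)))\<^sup>2) = (\<Sum>n\<in>(\<lambda>n. n - j) ` {i..m}. (norm (V n))\<^sup>2)"
      by (simp add: sum.reindex[OF inj])
    also have "\<dots> \<le> (\<Sum>n=0..m. (norm (V n))\<^sup>2)"
      by (rule sum_mono2) auto
    finally show "L2_set (\<lambda>n. norm (V (n - j))) {i..m} \<le> L2_set (\<lambda>n. norm (V n)) {0..m}"
      by (simp add: L2_set_def)
  qed simp
  also have "\<dots> = (\<Sum>j\<le>l. \<bar>b j\<bar>) * L2_set (\<lambda>n. norm (V n)) {0..m}"
    by (simp add: sum_distrib_right)
  finally show ?thesis
    using assms(1) by (simp add: ell2_norm_L2_set mult_left_mono mult.left_commute)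
qed

lemma M_tau_add: "M_tau b l (\<lambda>i. V i + W i) n = M_tau b l V n + M_tau b l W n"
  by (simp add: M_tau_def scaleR_add_right sum.distrib)

lemma M_tau_scaleR: "M_tau b l (\<lambda>i. c *\<^sub>R V i) n = c *\<^sub>R M_tau b l V n"
  by (simp add: M_tau_def scaleR_sum_right mult.commute)

lemma D_plus_M_tau:
  assumes "l \<le> n"
  shows "D_plus \<tau> (M_tau b l V) n = M_tau b l (D_plus \<tau> V) n"
proof -
  have "(\<Sum>j\<le>l. b j *\<^sub>R V (n + 1 - j)) = (\<Sum>j\<le>l. b j *\<^sub>R V (n - j + 1))"
    using assms by (intro sum.cong) (auto simp: Suc_diff_le)
  then show ?thesis
    by (simp add: D_plus_def M_tau_def scaleR_sum_right sum_subtractf scaleR_diff_right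
        mult.commute)
qed

lemma inner_M_tau_left:
  "inner (M_tau b l V n) w = (\<Sum>j\<le>l. b j * inner (V (n - j)) w)"
  by (simp add: M_tau_def inner_sum_left)

lemma inner_M_tau_right:
  "inner w (M_tau b l V n) = (\<Sum>j\<le>l. b j * inner w (V (n - j)))"
  by (simp add: M_tau_def inner_sum_right)

lemma inner_D_minus_left:
  "inner (D_minus \<tau> V n) w = (inner (V n) w - inner (V (n - 1)) w) / \<tau>"
  by (simp add: D_minus_def inner_diff_left divide_inverse mult.commute)

lemma inner_D_minus_right:
  "inner w (D_minus \<tau> V n) = (inner w (V n) - inner w (V (n - 1))) / \<tau>"
  by (simp add: D_minus_def inner_diff_right divide_inverse mult.commute)

section \<open>The pairing with the test sequence\<close>

lemma ell2_norm_D_minus: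
  assumes "1 \<le> i" "i \<le> j"
  shows "ell2_norm \<tau> i j (D_minus \<tau> V) = ell2_norm \<tau> (i - 1) (j - 1) (D_plus \<tau> V)"
proof -
  obtain i' j' where "i = Suc i'" "j = Suc j'"
    using assms by (metis Suc_le_D One_nat_def le_trans)
  then show ?thesis
    by (simp add: ell2_norm_def D_minus_def D_plus_def sum.shift_bounds_cl_Suc_ivl del: sum.cl_ivl_Suc)
qed

text \<open>The algebraic heart.  Orthogonality removes \<open>(D\<^sup>- y, M V)\<close>, and by skew-symmetry
\<open>(M x, M V) = - (M y, M g) = - (M y, a)\<close>, where the part \<open>D\<^sup>- V\<close> of \<open>a\<close> may be inserted because it is
again orthogonal to \<open>y\<close>.  Finally \<open>(D\<^sup>- y, D\<^sup>- g) = - (D\<^sup>- x, D\<^sup>- V)\<close>.\<close>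

lemma projection_error_pairing:
  fixes x y V g :: "nat \<Rightarrow> 'a::real_inner"
  assumes n: "l \<le> n" "1 \<le> n" "n \<le> N"
    and orth: "\<And>i j. i \<le> N \<Longrightarrow> inner (y i) (V j) = 0"
    and skew: "\<And>i j. i \<le> N \<Longrightarrow> inner (x i) (V j) = - inner (y i) (g j)"
    and a: "a n = D_minus \<tau> V n + M_tau b l g n"
  shows "inner (D_minus \<tau> y n + M_tau b l x n)
      (M_tau b l V n + \<delta> *\<^sub>R a n + \<delta>\<^sup>2 *\<^sub>R D_minus \<tau> g n) =
    \<delta> * inner (D_minus \<tau> y n) (a n) - \<delta>\<^sup>2 * inner (D_minus \<tau> x n) (D_minus \<tau> V n)
    - inner (M_tau b l y n) (a n) + \<delta> * inner (M_tau b l x n) (a n)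
    + \<delta>\<^sup>2 * inner (M_tau b l x n) (D_minus \<tau> g n)"
proof -
  have 1: "inner (D_minus \<tau> y n) (M_tau b l V n) = 0"
    using n by (simp add: inner_D_minus_left inner_M_tau_right orth)
  have 2: "inner (D_minus \<tau> y n) (D_minus \<tau> g n) = - inner (D_minus \<tau> x n) (D_minus \<tau> V n)"
    using n by (simp add: inner_D_minus_left inner_D_minus_right skew) (simp add: field_simps diff_divide_distrib)
  have 3: "inner (M_tau b l x n) (M_tau b l V n) = - inner (M_tau b l y n) (M_tau b l g n)"
    using n by (simp add: inner_M_tau_left inner_M_tau_right skew sum_negf)
  have 4: "inner (M_tau b l y n) (D_minus \<tau> V n) = 0"
    using n by (simp add: inner_D_minus_right inner_M_tau_left orth)
  show ?thesis
    by (simp add: inner_add_left inner_add_right 1 2 3 4 a algebra_simps)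
qed

text \<open>Each of the five terms of the preceding identity is estimated by the energy bound \<open>\<omega>\<close>: those with \<open>a\<close>
by Cauchy-Schwarz, those with a difference quotient of \<open>V\<close> or \<open>g\<close> through summation by parts.  The
hypothesis \<open>\<delta> \<le> 1\<close> absorbs the surplus powers of \<open>\<delta>\<close>.\<close>

lemma projection_error_pairing_le:
  fixes x y V g :: "nat \<Rightarrow> 'a::real_inner"
  assumes \<tau>: "0 < \<tau>" and \<delta>: "0 < \<delta>" "\<delta> \<le> 1"
    and n: "l \<le> n0" "1 \<le> n0" "n0 \<le> m" "m \<le> N" "real N * \<tau> \<le> T"
    and orth: "\<And>i j. i \<le> N \<Longrightarrow> inner (y i) (V j) = 0"
    and skew: "\<And>i j. i \<le> N \<Longrightarrow> inner (x i) (V j) = - inner (y i) (g j)"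
    and a: "a = (\<lambda>n. D_minus \<tau> V n + M_tau b l g n)"
    and V_le: "\<And>j. j \<le> m \<Longrightarrow> norm (V j) \<le> \<omega>"
    and g_le: "\<And>j. j \<le> m \<Longrightarrow> \<delta> * norm (g j) \<le> \<omega>"
    and a_le: "sqrt \<delta> * ell2_norm \<tau> n0 m a \<le> \<omega>"
    and y_le: "ell2_norm \<tau> 0 N y \<le> Ky" and Dy_le: "ell2_norm \<tau> 0 (N - 1) (D_plus \<tau> y) \<le> Ky"
    and x_le: "\<And>i. i \<le> N \<Longrightarrow> norm (x i) \<le> Kx"
    and Dx_le: "\<And>i. i < N \<Longrightarrow> norm (D_plus \<tau> x i) \<le> Kx"
    and ell2_Dx_le: "ell2_norm \<tau> 0 (N - 1) (D_plus \<tau> x) \<le> Kx"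
    and ell2_DDx_le: "ell2_norm \<tau> 1 (N - 1) (D_plus \<tau> (D_minus \<tau> x)) \<le> Kx"
    and \<beta>: "\<beta> = (\<Sum>j\<le>l. \<bar>b j\<bar>)"
  shows "\<tau> * (\<Sum>n=n0..m. inner (D_minus \<tau> y n + M_tau b l x n)
      (M_tau b l V n + \<delta> *\<^sub>R a n + \<delta>\<^sup>2 *\<^sub>R D_minus \<tau> g n))
    \<le> (2 + 3 * \<beta>) * (Ky / sqrt \<delta> + sqrt \<delta> * (1 + sqrt T) * Kx) * \<omega>"
proof -
  define S where "S R W = \<tau> * (\<Sum>n=n0..m. inner (R n) (W n))" for R W :: "nat \<Rightarrow> 'a"
  have T: "0 \<le> T"
    using \<tau> n(5) by (meson less_imp_le mult_nonneg_nonneg of_nat_0_le_iff order_trans)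
  have \<omega>: "0 \<le> \<omega>" and Kx: "0 \<le> Kx" and \<beta>0: "0 \<le> \<beta>"
    using V_le[of 0] x_le[of 0] norm_ge_zero order_trans \<beta> by (blast, blast, simp add: sum_nonneg)
  have Ky: "0 \<le> Ky"
    using y_le ell2_norm_nonneg[of \<tau> 0 N y] \<tau> by linarith
  have sd: "sqrt \<delta> * sqrt \<delta> = \<delta>" "0 < sqrt \<delta>" using \<delta> by auto
  have \<delta>_sd: "\<delta> \<le> sqrt \<delta>" "\<delta>\<^sup>2 \<le> \<delta>"
    using \<delta> by (auto intro!: real_le_rsqrt simp: power2_eq_square mult_le_one mult_left_le)
  have \<delta>_y: "Ky * sqrt \<delta> \<le> Ky / sqrt \<delta>"
    using \<delta> sd Ky by (simp add: field_simps mult_left_le)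
  have S_a: "\<bar>S R a\<bar> \<le> K * \<omega> / sqrt \<delta>" if R: "ell2_norm \<tau> n0 m R \<le> K" for R K
  proof -
    have "\<bar>S R a\<bar> \<le> ell2_norm \<tau> n0 m R * ell2_norm \<tau> n0 m a"
      unfolding S_def using \<tau> by (intro inner_sum_le_ell2_norm) simp
    also have "\<dots> \<le> K * (\<omega> / sqrt \<delta>)"
    proof (intro mult_mono R ell2_norm_nonneg)
      show "ell2_norm \<tau> n0 m a \<le> \<omega> / sqrt \<delta>"
        using a_le sd by (simp add: field_simps)
      show "0 \<le> K"
        using R ell2_norm_nonneg[of \<tau> n0 m R] \<tau> by linarith
    qed (use \<tau> in simp)
    finally show ?thesis by simp
  qed
  have "ell2_norm \<tau> n0 m (D_minus \<tau> y) \<le> Ky"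
    using n \<tau> by (subst ell2_norm_D_minus)
      (auto intro!: order_trans[OF ell2_norm_mono_range Dy_le])
  from S_a[OF this] have t1: "\<bar>S (D_minus \<tau> y) a\<bar> \<le> Ky * \<omega> / sqrt \<delta>" .
  have "ell2_norm \<tau> n0 m (M_tau b l y) \<le> \<beta> * ell2_norm \<tau> 0 m y"
    unfolding \<beta> using n \<tau> by (intro ell2_norm_M_tau_le) auto
  also have "\<dots> \<le> \<beta> * Ky"
    using n \<tau> by (intro mult_left_mono order_trans[OF ell2_norm_mono_range y_le] \<beta>0) auto
  finally have "ell2_norm \<tau> n0 m (M_tau b l y) \<le> \<beta> * Ky" .
  from S_a[OF this] have t3: "\<bar>S (M_tau b l y) a\<bar> \<le> \<beta> * Ky * \<omega> / sqrt \<delta>" .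
  have Mx: "norm (M_tau b l x n) \<le> \<beta> * Kx" if "n \<le> N" for n
    unfolding \<beta> using that by (intro norm_M_tau_le_sup x_le) simp
  have "ell2_norm \<tau> n0 m (M_tau b l x) \<le> sqrt T * (\<beta> * Kx)"
    using n \<tau> \<beta>0 Kx by (intro ell2_norm_le_sup[where N = N] Mx) auto
  from S_a[OF this] have t4: "\<bar>S (M_tau b l x) a\<bar> \<le> sqrt T * (\<beta> * Kx) * \<omega> / sqrt \<delta>" .
  have t2: "\<bar>S (D_minus \<tau> x) (D_minus \<tau> V)\<bar> \<le> 2 * (1 + sqrt T) * Kx * \<omega>"
    unfolding S_def
  proof (rule inner_D_minus_sum_le)
    show "norm (D_minus \<tau> x n) \<le> Kx" if "n0 \<le> n" "n \<le> N" for n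
      using Dx_le[of "n - 1"] that n by (simp add: D_plus_def D_minus_def)
    show "ell2_norm \<tau> n0 (N - 1) (D_plus \<tau> (D_minus \<tau> x)) \<le> Kx"
      using \<tau> n by (intro order_trans[OF ell2_norm_mono_range ell2_DDx_le]) auto
  qed (use assms Kx in auto)
  have t5': "\<bar>S (M_tau b l x) (D_minus \<tau> (\<lambda>i. \<delta> *\<^sub>R g i))\<bar> \<le> 2 * (1 + sqrt T) * (\<beta> * Kx) * \<omega>"
    unfolding S_def
  proof (rule inner_D_minus_sum_le)
    show "norm (M_tau b l x n) \<le> \<beta> * Kx" if "n0 \<le> n" "n \<le> N" for n
      using Mx that by simp
    have "ell2_norm \<tau> n0 (N - 1) (D_plus \<tau> (M_tau b l x)) = ell2_norm \<tau> n0 (N - 1) (M_tau b l (D_plus \<tau> x))"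
      using n by (simp add: ell2_norm_def D_plus_M_tau)
    also have "\<dots> \<le> \<beta> * ell2_norm \<tau> 0 (N - 1) (D_plus \<tau> x)"
      unfolding \<beta> using n \<tau> by (intro ell2_norm_M_tau_le) auto
    also have "\<dots> \<le> \<beta> * Kx"
      by (intro mult_left_mono ell2_Dx_le \<beta>0)
    finally show "ell2_norm \<tau> n0 (N - 1) (D_plus \<tau> (M_tau b l x)) \<le> \<beta> * Kx" .
    show "norm (\<delta> *\<^sub>R g j) \<le> \<omega>" if "j \<le> m" for j
      using g_le[OF that] \<delta> by simp
  qed (use assms Kx \<beta>0 in auto)
  have D_g: "D_minus \<tau> (\<lambda>i. \<delta> *\<^sub>R g i) n = \<delta> *\<^sub>R D_minus \<tau> g n" for n
    by (simp add: D_minus_def scaleR_diff_right mult.commute)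
  have t5: "\<bar>\<delta> * S (M_tau b l x) (D_minus \<tau> g)\<bar> \<le> 2 * (1 + sqrt T) * (\<beta> * Kx) * \<omega>"
    using t5' by (simp add: S_def D_g sum_distrib_left mult.left_commute)
  have abs_scaled_le: "\<bar>c * z\<bar> \<le> c * K" if "\<bar>z\<bar> \<le> K" "0 \<le> c" for c z K :: real
    using that by (simp add: abs_mult mult_left_mono)
  have "\<tau> * (\<Sum>n=n0..m. inner (D_minus \<tau> y n + M_tau b l x n)
      (M_tau b l V n + \<delta> *\<^sub>R a n + \<delta>\<^sup>2 *\<^sub>R D_minus \<tau> g n)) =
    \<tau> * (\<Sum>n=n0..m. \<delta> * inner (D_minus \<tau> y n) (a n)
      - \<delta>\<^sup>2 * inner (D_minus \<tau> x n) (D_minus \<tau> V n)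
      - inner (M_tau b l y n) (a n) + \<delta> * inner (M_tau b l x n) (a n)
      + \<delta>\<^sup>2 * inner (M_tau b l x n) (D_minus \<tau> g n))"
    using n by (intro arg_cong2[where f = times] refl sum.cong
        projection_error_pairing[where N = N] orth skew) (auto simp: a)
  also have "\<dots> = \<delta> * S (D_minus \<tau> y) a - \<delta>\<^sup>2 * S (D_minus \<tau> x) (D_minus \<tau> V)
      - S (M_tau b l y) a + \<delta> * S (M_tau b l x) a + \<delta> * (\<delta> * S (M_tau b l x) (D_minus \<tau> g))"
    by (simp add: S_def sum.distrib sum_subtractf sum_distrib_left algebra_simps power2_eq_square)
  also have "\<dots> \<le> \<bar>\<delta> * S (D_minus \<tau> y) a\<bar> + \<bar>\<delta>\<^sup>2 * S (D_minus \<tau> x) (D_minus \<tau> V)\<bar>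
      + \<bar>S (M_tau b l y) a\<bar> + \<bar>\<delta> * S (M_tau b l x) a\<bar> + \<bar>\<delta> * (\<delta> * S (M_tau b l x) (D_minus \<tau> g))\<bar>"
    by linarith
  also have "\<dots> \<le> Ky / sqrt \<delta> * \<omega> + sqrt \<delta> * (2 * (1 + sqrt T) * Kx * \<omega>)
      + \<beta> * Ky * \<omega> / sqrt \<delta> + sqrt \<delta> * ((1 + sqrt T) * (\<beta> * Kx) * \<omega>)
      + sqrt \<delta> * (2 * (1 + sqrt T) * (\<beta> * Kx) * \<omega>)"
  proof (intro add_mono t3)
    have "\<bar>\<delta> * S (D_minus \<tau> y) a\<bar> \<le> \<delta> * (Ky * \<omega> / sqrt \<delta>)"
      using \<delta> by (intro abs_scaled_le t1) auto
    also have "\<dots> \<le> 1 * (Ky * \<omega> / sqrt \<delta>)"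
      using \<delta> Ky \<omega> by (intro mult_right_mono) auto
    finally show "\<bar>\<delta> * S (D_minus \<tau> y) a\<bar> \<le> Ky / sqrt \<delta> * \<omega>" by simp
    have "\<bar>\<delta>\<^sup>2 * S (D_minus \<tau> x) (D_minus \<tau> V)\<bar> \<le> \<delta>\<^sup>2 * (2 * (1 + sqrt T) * Kx * \<omega>)"
      using \<delta> by (intro abs_scaled_le t2) auto
    also have "\<dots> \<le> sqrt \<delta> * (2 * (1 + sqrt T) * Kx * \<omega>)"
      using \<delta>_sd T Kx \<omega> by (intro mult_right_mono) auto
    finally show "\<bar>\<delta>\<^sup>2 * S (D_minus \<tau> x) (D_minus \<tau> V)\<bar> \<le> sqrt \<delta> * (2 * (1 + sqrt T) * Kx * \<omega>)" .
    have "\<bar>\<delta> * S (M_tau b l x) a\<bar> \<le> \<delta> * (sqrt T * (\<beta> * Kx) * \<omega> / sqrt \<delta>)"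
      using \<delta> by (intro abs_scaled_le t4) auto
    also have "\<dots> = sqrt \<delta> * (sqrt T * (\<beta> * Kx) * \<omega>)"
      using sd by (simp add: field_simps)
    also have "\<dots> \<le> sqrt \<delta> * ((1 + sqrt T) * (\<beta> * Kx) * \<omega>)"
      using \<beta>0 Kx \<omega> \<delta> by (intro mult_left_mono mult_right_mono) auto
    finally show "\<bar>\<delta> * S (M_tau b l x) a\<bar> \<le> sqrt \<delta> * ((1 + sqrt T) * (\<beta> * Kx) * \<omega>)" .
    have "\<bar>\<delta> * (\<delta> * S (M_tau b l x) (D_minus \<tau> g))\<bar> \<le> \<delta> * (2 * (1 + sqrt T) * (\<beta> * Kx) * \<omega>)"
      using \<delta> by (intro abs_scaled_le t5) auto
    also have "\<dots> \<le> sqrt \<delta> * (2 * (1 + sqrt T) * (\<beta> * Kx) * \<omega>)"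
      using \<delta>_sd T Kx \<omega> \<beta>0 by (intro mult_right_mono) auto
    finally show "\<bar>\<delta> * (\<delta> * S (M_tau b l x) (D_minus \<tau> g))\<bar>
        \<le> sqrt \<delta> * (2 * (1 + sqrt T) * (\<beta> * Kx) * \<omega>)" .
  qed
  also have "\<dots> = (1 + \<beta>) * (Ky / sqrt \<delta> * \<omega>) + (2 + 3 * \<beta>) * (sqrt \<delta> * (1 + sqrt T) * Kx * \<omega>)"
    by (simp add: algebra_simps add_divide_distrib)
  also have "\<dots> \<le> (2 + 3 * \<beta>) * (Ky / sqrt \<delta> * \<omega>) + (2 + 3 * \<beta>) * (sqrt \<delta> * (1 + sqrt T) * Kx * \<omega>)"
    using \<beta>0 Ky \<omega> sd by (intro add_right_mono mult_right_mono) auto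
  also have "\<dots> = (2 + 3 * \<beta>) * (Ky / sqrt \<delta> + sqrt \<delta> * (1 + sqrt T) * Kx) * \<omega>"
    by (simp add: algebra_simps)
  finally show ?thesis .
qed

text \<open>Cauchy-Schwarz in time for the part \<open>M t\<close>, summation by parts for the part \<open>\<delta> D\<^sup>- t\<close>.\<close>

lemma residual_pairing_le:
  fixes \<rho> t :: "nat \<Rightarrow> 'a::real_inner"
  assumes \<tau>: "0 < \<tau>" and \<delta>: "0 < \<delta>" "\<delta> \<le> 1"
    and n: "1 \<le> n0" "n0 \<le> m" "m \<le> N" "real N * \<tau> \<le> T"
    and t_le: "\<And>j. j \<le> m \<Longrightarrow> norm (t j) \<le> \<omega>"
    and ell2_\<rho>: "ell2_norm \<tau> n0 N \<rho> \<le> P"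
    and \<rho>: "\<And>n. n0 \<le> n \<Longrightarrow> n \<le> N \<Longrightarrow> norm (\<rho> n) \<le> P"
    and D\<rho>: "ell2_norm \<tau> n0 (N - 1) (D_plus \<tau> \<rho>) \<le> P"
    and \<beta>: "\<beta> = (\<Sum>j\<le>l. \<bar>b j\<bar>)"
  shows "\<bar>\<tau> * (\<Sum>n=n0..m. inner (\<rho> n) (M_tau b l t n + \<delta> *\<^sub>R D_minus \<tau> t n))\<bar>
    \<le> (2 + \<beta>) * ((1 + sqrt T) * P) * \<omega>"
proof -
  have T: "0 \<le> T"
    using \<tau> n(4) by (meson less_imp_le mult_nonneg_nonneg of_nat_0_le_iff order_trans)
  have \<omega>: "0 \<le> \<omega>"
    using t_le[of 0] norm_ge_zero order_trans by blast
  have P: "0 \<le> P"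
    using ell2_\<rho> ell2_norm_nonneg[of \<tau> n0 N \<rho>] \<tau> by linarith
  have \<beta>0: "0 \<le> \<beta>"
    unfolding \<beta> by (simp add: sum_nonneg)
  have Mt: "norm (M_tau b l t n) \<le> \<beta> * \<omega>" if "n \<le> m" for n
    unfolding \<beta> using that by (intro norm_M_tau_le_sup t_le) simp
  have "\<bar>\<tau> * (\<Sum>n=n0..m. inner (\<rho> n) (M_tau b l t n))\<bar> \<le> \<tau> * (\<Sum>n=n0..m. norm (\<rho> n) * (\<beta> * \<omega>))"
    using \<tau> by (auto simp: abs_mult intro!: mult_left_mono order_trans[OF sum_abs] sum_mono
        order_trans[OF Cauchy_Schwarz_ineq2] Mt)
  also have "\<dots> = \<tau> * (\<Sum>n=n0..m. norm (\<rho> n)) * (\<beta> * \<omega>)"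
    by (simp add: sum_distrib_right mult.assoc)
  also have "\<dots> \<le> sqrt T * ell2_norm \<tau> n0 m \<rho> * (\<beta> * \<omega>)"
    using \<tau> n \<beta>0 \<omega> by (intro mult_right_mono norm_sum_le_ell2_norm[where N = N]) auto
  also have "\<dots> \<le> (1 + sqrt T) * P * (\<beta> * \<omega>)"
    using \<tau> n T P \<beta>0 \<omega>
    by (intro mult_right_mono mult_mono order_trans[OF ell2_norm_mono_range ell2_\<rho>] ell2_norm_nonneg) auto
  finally have 1: "\<bar>\<tau> * (\<Sum>n=n0..m. inner (\<rho> n) (M_tau b l t n))\<bar> \<le> (1 + sqrt T) * P * (\<beta> * \<omega>)" .
  have "\<bar>\<tau> * (\<Sum>n=n0..m. inner (\<rho> n) (D_minus \<tau> t n))\<bar> \<le> 2 * (1 + sqrt T) * P * \<omega>"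
    by (rule inner_D_minus_sum_le) (use assms P in auto)
  then have "\<delta> * \<bar>\<tau> * (\<Sum>n=n0..m. inner (\<rho> n) (D_minus \<tau> t n))\<bar> \<le> 1 * (2 * (1 + sqrt T) * P * \<omega>)"
    using \<delta> by (intro mult_mono) auto
  moreover have "\<tau> * (\<Sum>n=n0..m. inner (\<rho> n) (M_tau b l t n + \<delta> *\<^sub>R D_minus \<tau> t n)) =
      \<tau> * (\<Sum>n=n0..m. inner (\<rho> n) (M_tau b l t n)) + \<delta> * (\<tau> * (\<Sum>n=n0..m. inner (\<rho> n) (D_minus \<tau> t n)))"
    by (simp add: inner_add_right sum.distrib sum_distrib_left algebra_simps)
  moreover have "\<bar>\<delta> * (\<tau> * (\<Sum>n=n0..m. inner (\<rho> n) (D_minus \<tau> t n)))\<bar>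
      = \<delta> * \<bar>\<tau> * (\<Sum>n=n0..m. inner (\<rho> n) (D_minus \<tau> t n))\<bar>"
    using \<delta> by (simp add: abs_mult)
  ultimately have "\<bar>\<tau> * (\<Sum>n=n0..m. inner (\<rho> n) (M_tau b l t n + \<delta> *\<^sub>R D_minus \<tau> t n))\<bar>
      \<le> (1 + sqrt T) * P * (\<beta> * \<omega>) + 2 * (1 + sqrt T) * P * \<omega>"
    using 1 by linarith
  also have "\<dots> = (2 + \<beta>) * ((1 + sqrt T) * P) * \<omega>"
    by (simp add: algebra_simps)
  finally show ?thesis .
qed

section \<open>Sampling a function of time\<close>

text \<open>Exceptional null sets are removed by changing both functions to \<open>0\<close> there.\<close>

lemma has_integral_le_off_negligible:
  fixes f g :: "real \<Rightarrow> real"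
  assumes f: "(f has_integral i) S" and g: "(g has_integral j) S" and Z: "negligible Z"
    and le: "\<And>t. t \<in> S - Z \<Longrightarrow> f t \<le> g t"
  shows "i \<le> j"
proof (rule has_integral_le)
  show "((\<lambda>t. if t \<in> Z then 0 else f t) has_integral i) S"
    by (rule has_integral_spike[OF Z _ f]) simp
  show "((\<lambda>t. if t \<in> Z then 0 else g t) has_integral j) S"
    by (rule has_integral_spike[OF Z _ g]) simp
qed (use le in auto)

lemma time_derivative_increment_le:
  fixes u u' g :: "real \<Rightarrow> real"
  assumes u: "time_derivative T u u'" and Z: "negligible Z"
    and le: "\<And>t. t \<in> {0..T} - Z \<Longrightarrow> \<bar>u' t\<bar> \<le> g t" and g: "g integrable_on {0..T}"
    and ab: "0 \<le> a" "a \<le> b" "b \<le> T"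
  shows "\<bar>u b - u a\<bar> \<le> integral {a..b} g"
proof -
  have u': "(u' has_integral (u b - u a)) {a..b}"
    using u ab by (simp add: time_derivative_def)
  have g': "(g has_integral integral {a..b} g) {a..b}"
    using g ab by (intro integrable_integral integrable_on_subinterval[OF g]) auto
  have bound: "u' t \<le> g t" "- u' t \<le> g t" if "t \<in> {a..b} - Z" for t
    using le[of t] that ab by (auto simp: abs_le_iff)
  have "u b - u a \<le> integral {a..b} g"
    by (rule has_integral_le_off_negligible[OF u' g' Z bound(1)])
  moreover have "- (u b - u a) \<le> integral {a..b} g"
    by (rule has_integral_le_off_negligible[OF has_integral_neg[OF u'] g' Z bound(2)])
  ultimately show ?thesis by linarith
qed

text \<open>A sampled value exceeds the value at any other time of the cell by at most the integral of the
derivative; averaging over that time gives the claim.  This is what makes sampled norms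
controllable by integrals without a factor \<open>T\<close>.\<close>

lemma time_derivative_value_le:
  fixes u u' g0 g1 :: "real \<Rightarrow> real"
  assumes u: "time_derivative T u u'" and Z: "negligible Z"
    and le0: "\<And>t. t \<in> {0..T} - Z \<Longrightarrow> \<bar>u t\<bar> \<le> g0 t" and g0: "g0 integrable_on {0..T}"
    and le1: "\<And>t. t \<in> {0..T} - Z \<Longrightarrow> \<bar>u' t\<bar> \<le> g1 t" and g1: "g1 integrable_on {0..T}"
    and g1_nonneg: "\<And>t. 0 \<le> g1 t"
    and I: "0 \<le> a" "a \<le> b" "b \<le> T" and t: "t \<in> {a..b}"
  shows "(b - a) * \<bar>u t\<bar> \<le> integral {a..b} g0 + (b - a) * integral {a..b} g1"
proof -
  have g0': "(g0 has_integral integral {a..b} g0) {a..b}"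
    using I by (intro integrable_integral integrable_on_subinterval[OF g0]) auto
  have g1': "g1 integrable_on {a..b}"
    using I by (intro integrable_on_subinterval[OF g1]) auto
  have close: "\<bar>u t\<bar> - integral {a..b} g1 \<le> g0 s" if s: "s \<in> {a..b} - Z" for s
  proof -
    have "\<bar>u (max s t) - u (min s t)\<bar> \<le> integral {min s t..max s t} g1"
      using s t I by (intro time_derivative_increment_le[OF u Z le1 g1]) auto
    also have "\<dots> \<le> integral {a..b} g1"
      using s t I by (intro integral_subset_le integrable_on_subinterval[OF g1] g1') (auto simp: g1_nonneg)
    finally have "\<bar>u t - u s\<bar> \<le> integral {a..b} g1"
      by (auto simp: max_def min_def split: if_splits)
    moreover have "\<bar>u s\<bar> \<le> g0 s"
      using s I by (intro le0) auto
    ultimately show ?thesis by linarith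
  qed
  have "((\<lambda>s. \<bar>u t\<bar> - integral {a..b} g1) has_integral (b - a) *\<^sub>R (\<bar>u t\<bar> - integral {a..b} g1)) {a..b}"
    using has_integral_const_real[of "\<bar>u t\<bar> - integral {a..b} g1" a b] I by simp
  from has_integral_le_off_negligible[OF this g0' Z close]
  show ?thesis by (simp add: algebra_simps)
qed

text \<open>The bounds hold off a null set, the conclusion at every point: averaging over an interval of width
\<open>w\<close> around \<open>t\<close> gives \<open>M0 + M1 * w\<close>, and \<open>w\<close> is arbitrarily small.\<close>

lemma time_derivative_sup_le:
  fixes u u' :: "real \<Rightarrow> real"
  assumes T: "0 < T" and u: "time_derivative T u u'" and Z: "negligible Z"
    and le0: "\<And>t. t \<in> {0..T} - Z \<Longrightarrow> \<bar>u t\<bar> \<le> M0"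
    and le1: "\<And>t. t \<in> {0..T} - Z \<Longrightarrow> \<bar>u' t\<bar> \<le> M1" and M1: "0 \<le> M1"
    and t: "t \<in> {0..T}"
  shows "\<bar>u t\<bar> \<le> M0"
proof (rule field_le_epsilon)
  fix e :: real assume e: "0 < e"
  \<comment> \<open>adding \<open>1\<close> admits \<open>M1 = 0\<close>\<close>
  define w where "w = min T (e / (M1 + 1))"
  have w: "0 < w" "w \<le> T" "M1 * w \<le> e"
    using T M1 e unfolding w_def
    by (auto simp: field_simps min_def intro: order_trans[OF mult_left_mono])
  \<comment> \<open>the interval extends to the right of \<open>t\<close> where there is room, and ends at \<open>T\<close> otherwise\<close>
  obtain a where a: "0 \<le> a" "a + w \<le> T" "t \<in> {a..a + w}"
  proof (cases "t + w \<le> T")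
    case True
    then show ?thesis using that[of t] t w by auto
  next
    case False
    then show ?thesis using that[of "T - w"] t w by auto
  qed
  have "(a + w - a) * \<bar>u t\<bar> \<le> integral {a..a + w} (\<lambda>t. M0) + (a + w - a) * integral {a..a + w} (\<lambda>t. M1)"
    using a w M1 by (intro time_derivative_value_le[OF u Z le0 _ le1]) auto
  then have "w * \<bar>u t\<bar> \<le> w * (M0 + M1 * w)"
    using w by (simp add: algebra_simps)
  then have "\<bar>u t\<bar> \<le> M0 + M1 * w"
    using w by simp
  then show "\<bar>u t\<bar> \<le> M0 + e"
    using w by simp
qed

text \<open>The second difference of \<open>u\<close> is the integral over a cell of the first difference of \<open>u'\<close>, which in
turn is the integral of \<open>u''\<close> over a cell.\<close>

lemma time_derivative_second_difference_le:
  fixes u u' u'' g :: "real \<Rightarrow> real"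
  assumes u: "time_derivative T u u'" and u': "time_derivative T u' u''" and Z: "negligible Z"
    and le: "\<And>t. t \<in> {0..T} - Z \<Longrightarrow> \<bar>u'' t\<bar> \<le> g t" and g: "g integrable_on {0..T}"
    and g_nonneg: "\<And>t. 0 \<le> g t"
    and t: "0 \<le> t - \<tau>" "t + \<tau> \<le> T" "0 \<le> \<tau>"
  shows "\<bar>(u (t + \<tau>) - u t) - (u t - u (t - \<tau>))\<bar> \<le> \<tau> * integral {t - \<tau>..t + \<tau>} g"
proof -
  have right: "(u' has_integral (u (t + \<tau>) - u t)) {t..t + \<tau>}"
    and left: "(u' has_integral (u t - u (t - \<tau>))) {t - \<tau>..t}"
    using u t by (auto simp: time_derivative_def)
  have "((\<lambda>s. u' (s + \<tau>)) has_integral (u (t + \<tau>) - u t)) {t - \<tau>..t}"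
    using has_integral_shift_real_ivl[OF right, of \<tau>] by simp
  from has_integral_diff[OF this left]
  have diff: "((\<lambda>s. u' (s + \<tau>) - u' s) has_integral ((u (t + \<tau>) - u t) - (u t - u (t - \<tau>)))) {t - \<tau>..t}" .
  have bound: "u' (s + \<tau>) - u' s \<le> integral {t - \<tau>..t + \<tau>} g"
      "- (u' (s + \<tau>) - u' s) \<le> integral {t - \<tau>..t + \<tau>} g" if s: "s \<in> {t - \<tau>..t}" for s
  proof -
    have "\<bar>u' (s + \<tau>) - u' s\<bar> \<le> integral {s..s + \<tau>} g"
      using s t by (intro time_derivative_increment_le[OF u' Z le g]) auto
    also have "\<dots> \<le> integral {t - \<tau>..t + \<tau>} g"
      using s t by (intro integral_subset_le integrable_on_subinterval[OF g]) (auto simp: g_nonneg)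
    finally have "\<bar>u' (s + \<tau>) - u' s\<bar> \<le> integral {t - \<tau>..t + \<tau>} g" .
    then show "u' (s + \<tau>) - u' s \<le> integral {t - \<tau>..t + \<tau>} g"
      "- (u' (s + \<tau>) - u' s) \<le> integral {t - \<tau>..t + \<tau>} g"
      by linarith+
  qed
  have const: "((\<lambda>s. integral {t - \<tau>..t + \<tau>} g) has_integral \<tau> * integral {t - \<tau>..t + \<tau>} g) {t - \<tau>..t}"
    using has_integral_const_real[of "integral {t - \<tau>..t + \<tau>} g" "t - \<tau>" t] t by simp
  have "(u (t + \<tau>) - u t) - (u t - u (t - \<tau>)) \<le> \<tau> * integral {t - \<tau>..t + \<tau>} g"
    by (rule has_integral_le[OF diff const bound(1)])
  moreover have "- ((u (t + \<tau>) - u t) - (u t - u (t - \<tau>))) \<le> \<tau> * integral {t - \<tau>..t + \<tau>} g"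
    by (rule has_integral_le[OF has_integral_neg[OF diff] const bound(2)])
  ultimately show ?thesis by linarith
qed

lemma integral_power2_le:
  fixes g :: "real \<Rightarrow> real"
  assumes g: "g integrable_on {a..b}" and g2: "(\<lambda>t. (g t)\<^sup>2) integrable_on {a..b}" and "a \<le> b"
  shows "(integral {a..b} g)\<^sup>2 \<le> (b - a) * integral {a..b} (\<lambda>t. (g t)\<^sup>2)"
proof (cases "a = b")
  case False
  define w where "w = b - a"
  define J where "J = integral {a..b} g"
  have w: "0 < w" using False assms(3) by (simp add: w_def)
  \<comment> \<open>the variance of \<open>g\<close> on the interval is nonnegative\<close>
  have "((\<lambda>t. (g t)\<^sup>2 - 2 * (J / w) * g t + (J / w)\<^sup>2) has_integral
      integral {a..b} (\<lambda>t. (g t)\<^sup>2) - 2 * (J / w) * J + w * (J / w)\<^sup>2) {a..b}"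
    unfolding J_def w_def using has_integral_const_real[of "(J / w)\<^sup>2" a b] assms(3)
    by (intro has_integral_add has_integral_diff has_integral_mult_right integrable_integral g g2)
       (simp add: J_def w_def)
  then have "0 \<le> integral {a..b} (\<lambda>t. (g t)\<^sup>2) - 2 * (J / w) * J + w * (J / w)\<^sup>2"
  proof (rule has_integral_nonneg)
    show "0 \<le> (g t)\<^sup>2 - 2 * (J / w) * g t + (J / w)\<^sup>2" for t
      using zero_le_power2[of "g t - J / w"] by (simp add: power2_diff algebra_simps)
  qed
  then have "0 \<le> w * (integral {a..b} (\<lambda>t. (g t)\<^sup>2) - 2 * (J / w) * J + w * (J / w)\<^sup>2)"
    using w by simp
  then show ?thesis
    using w by (simp add: power2_eq_square algebra_simps flip: J_def w_def)
qed simp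

lemma grid_cell_bounds:
  assumes "0 \<le> \<tau>" "real N * \<tau> \<le> T" "n < N"
  shows "0 \<le> real n * \<tau>" "real n * \<tau> \<le> real (n + 1) * \<tau>" "real (n + 1) * \<tau> \<le> T"
proof -
  have "real (n + 1) * \<tau> \<le> real N * \<tau>"
    using assms by (intro mult_right_mono) auto
  also note assms(2)
  finally show "real (n + 1) * \<tau> \<le> T" .
qed (use assms in \<open>auto intro: mult_right_mono\<close>)

lemma sum_integral_consecutive:
  fixes f :: "real \<Rightarrow> real"
  assumes f: "f integrable_on {0..T}" and "0 \<le> \<tau>" "real n * \<tau> \<le> T"
  shows "(\<Sum>i<n. integral {real i * \<tau>..real (i + 1) * \<tau>} f) = integral {0..real n * \<tau>} f"
  using assms(3)
proof (induction n)
  case (Suc n)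
  have *: "real n * \<tau> \<le> real (Suc n) * \<tau>"
    using assms(2) by (simp add: mult_right_mono)
  have "integral {0..real n * \<tau>} f + integral {real n * \<tau>..real (Suc n) * \<tau>} f
      = integral {0..real (Suc n) * \<tau>} f"
    using Suc.prems assms(2) *
    by (intro Henstock_Kurzweil_Integration.integral_combine integrable_on_subinterval[OF f]) auto
  then show ?case
    using Suc * by simp
qed simp

text \<open>Cauchy-Schwarz on each cell, where the factor \<open>\<tau>\<close> from the length of the cell cancels the \<open>1 / \<tau>\<close> in the
mean.  The cells do not overlap, so that their integrals add up to at most the integral over \<open>[0,T]\<close>.\<close>

lemma ell2_norm_le_of_cell_means:
  fixes g :: "real \<Rightarrow> real"
  assumes g: "g integrable_on {0..T}" and g2: "(\<lambda>t. (g t)\<^sup>2) integrable_on {0..T}"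
    and \<tau>: "0 < \<tau>" "real N * \<tau> \<le> T" "1 \<le> N" and "0 \<le> K"
    and R: "\<And>n. n < N \<Longrightarrow> \<tau> * norm (R n) \<le> K * integral {real n * \<tau>..real (n + 1) * \<tau>} g"
  shows "ell2_norm \<tau> 0 (N - 1) R \<le> K * sqrt (integral {0..T} (\<lambda>t. (g t)\<^sup>2))"
proof -
  let ?I = "\<lambda>n. {real n * \<tau>..real (n + 1) * \<tau>}"
  have sub: "?I n \<subseteq> {0..T}" if "n < N" for n
    using grid_cell_bounds[OF less_imp_le[OF \<tau>(1)] \<tau>(2) that] by auto
  have "\<tau> * (norm (R n))\<^sup>2 \<le> K\<^sup>2 * integral (?I n) (\<lambda>t. (g t)\<^sup>2)" if n: "n < N" for n
  proof -
    have "\<tau> * (\<tau> * (norm (R n))\<^sup>2) = (\<tau> * norm (R n))\<^sup>2"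
      by (simp add: power2_eq_square algebra_simps)
    also have "\<dots> \<le> (K * integral (?I n) g)\<^sup>2"
      using R[OF n] \<tau> by (intro power_mono) auto
    also have "\<dots> = K\<^sup>2 * (integral (?I n) g)\<^sup>2"
      by (simp add: power_mult_distrib)
    also have "\<dots> \<le> K\<^sup>2 * ((real (n + 1) * \<tau> - real n * \<tau>) * integral (?I n) (\<lambda>t. (g t)\<^sup>2))"
      using \<tau> integrable_on_subinterval[OF g sub[OF n]] integrable_on_subinterval[OF g2 sub[OF n]]
      by (intro mult_left_mono integral_power2_le) (auto simp: mult_right_mono)
    also have "\<dots> = \<tau> * (K\<^sup>2 * integral (?I n) (\<lambda>t. (g t)\<^sup>2))"
      by (simp add: algebra_simps)
    finally show ?thesis using \<tau> by simp
  qed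
  then have "(\<Sum>n<N. \<tau> * (norm (R n))\<^sup>2) \<le> (\<Sum>n<N. K\<^sup>2 * integral (?I n) (\<lambda>t. (g t)\<^sup>2))"
    by (intro sum_mono) auto
  also have "\<dots> = K\<^sup>2 * integral {0..real N * \<tau>} (\<lambda>t. (g t)\<^sup>2)"
    using sum_integral_consecutive[OF g2, of \<tau> N] \<tau> by (simp flip: sum_distrib_left)
  also have "\<dots> \<le> K\<^sup>2 * integral {0..T} (\<lambda>t. (g t)\<^sup>2)"
    using \<tau> g2 by (intro mult_left_mono integral_subset_le)
      (auto intro: integrable_on_subinterval)
  also have "(\<Sum>n<N. \<tau> * (norm (R n))\<^sup>2) = \<tau> * (\<Sum>n=0..N - 1. (norm (R n))\<^sup>2)"
  proof -
    have "{..<N} = {0..N - 1}" using \<tau> by auto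
    then show ?thesis by (simp add: sum_distrib_left)
  qed
  finally have "ell2_norm \<tau> 0 (N - 1) R \<le> sqrt (K\<^sup>2 * integral {0..T} (\<lambda>t. (g t)\<^sup>2))"
    unfolding ell2_norm_def by simp
  then show ?thesis
    using assms(6) by (simp add: real_sqrt_mult)
qed

section \<open>Sampling a vector-valued function through test vectors\<close>

text \<open>Test vectors approximating \<open>x\<close> itself give \<open>\<parallel>x\<parallel>\<^sup>2 \<le> M \<parallel>x\<parallel>\<close> in the limit.\<close>

lemma norm_le_of_dense_inner_le:
  fixes x :: "'a::real_inner"
  assumes x: "x \<in> closure W" and le: "\<And>w. w \<in> W \<Longrightarrow> inner x w \<le> M * norm w" and M: "0 \<le> M"
  shows "norm x \<le> M"
proof (cases "x = 0")
  case False
  obtain w where w: "\<And>n. w n \<in> W" "w \<longlonglongrightarrow> x"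
    using x by (auto simp: closure_sequential)
  have "inner x x \<le> M * norm x"
  proof (rule LIMSEQ_le)
    show "(\<lambda>n. inner x (w n)) \<longlonglongrightarrow> inner x x" "(\<lambda>n. M * norm (w n)) \<longlonglongrightarrow> M * norm x"
      using w(2) by (auto intro!: tendsto_intros)
  qed (use le w(1) in auto)
  then have "norm x * norm x \<le> M * norm x"
    by (simp add: dot_square_norm power2_eq_square)
  then show ?thesis using False by simp
qed (use M in simp)

text \<open>The samples \<open>X n\<close> are known only through their pairings with the dense set \<open>W\<close> of test vectors.  Each
pairing is the restriction to the grid of a scalar function \<open>u 0\<close> with successive derivatives \<open>u 1\<close>
and \<open>u 2\<close>, which \<open>g\<close> dominates off a null set, uniformly for \<open>w\<close> of norm one.  For the
samples of \<open>G\<close> applied to the projection error this avoids applying \<open>G\<close> to time derivatives at the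
exceptional times at which they lie outside its domain.\<close>

definition dominated_samples ::
    "real \<Rightarrow> real \<Rightarrow> nat \<Rightarrow> (nat \<Rightarrow> real \<Rightarrow> real) \<Rightarrow> real \<Rightarrow> 'a::real_inner set \<Rightarrow> (nat \<Rightarrow> 'a) \<Rightarrow> bool" where
  "dominated_samples T \<tau> N g K W X \<longleftrightarrow> subspace W \<and> (\<forall>n\<le>N. X n \<in> closure W) \<and>
     (\<forall>w\<in>W. \<exists>u Z. negligible Z \<and> time_derivative T (u 0) (u 1) \<and> time_derivative T (u 1) (u 2) \<and>
        (\<forall>n\<le>N. inner (X n) w = u 0 (real n * \<tau>)) \<and>
        (\<forall>j\<le>2. \<forall>t\<in>{0..T} - Z. \<bar>u (j::nat) t\<bar> \<le> K * norm w * g j t))"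

lemma subspace_closure:
  fixes W :: "'a::real_normed_vector set"
  assumes W: "subspace W"
  shows "subspace (closure W)"
proof (rule subspaceI)
  show "0 \<in> closure W"
    using subspace_0[OF W] closure_subset by blast
next
  fix x y assume "x \<in> closure W" "y \<in> closure W"
  then obtain v w where "\<And>n::nat. v n \<in> W" "v \<longlonglongrightarrow> x" "\<And>n::nat. w n \<in> W" "w \<longlonglongrightarrow> y"
    by (auto simp: closure_sequential)
  then show "x + y \<in> closure W"
    using W unfolding closure_sequential
    by (intro exI[of _ "\<lambda>n. v n + w n"]) (auto intro: tendsto_add subspace_add)
next
  fix c :: real and x assume "x \<in> closure W"
  then obtain v where "\<And>n::nat. v n \<in> W" "v \<longlonglongrightarrow> x"
    by (auto simp: closure_sequential)
  then show "c *\<^sub>R x \<in> closure W"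
    using W unfolding closure_sequential
    by (intro exI[of _ "\<lambda>n. c *\<^sub>R v n"]) (auto intro: tendsto_scaleR subspace_scale)
qed

lemma ell2_norm_triangle:
  assumes "0 \<le> \<tau>" and le: "\<And>n. i \<le> n \<Longrightarrow> n \<le> j \<Longrightarrow> norm (R n) \<le> r n + s n"
  shows "ell2_norm \<tau> i j R \<le> ell2_norm \<tau> i j (r :: nat \<Rightarrow> real) + ell2_norm \<tau> i j (s :: nat \<Rightarrow> real)"
proof -
  have "L2_set (\<lambda>n. norm (R n)) {i..j} \<le> L2_set (\<lambda>n. \<bar>r n\<bar> + \<bar>s n\<bar>) {i..j}"
  proof (rule L2_set_mono)
    fix n assume "n \<in> {i..j}"
    then show "norm (R n) \<le> \<bar>r n\<bar> + \<bar>s n\<bar>"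
      using le[of n] by auto
  qed simp
  also have "\<dots> \<le> L2_set (\<lambda>n. \<bar>r n\<bar>) {i..j} + L2_set (\<lambda>n. \<bar>s n\<bar>) {i..j}"
    by (rule L2_set_triangle_ineq)
  finally have "sqrt \<tau> * L2_set (\<lambda>n. norm (R n)) {i..j}
      \<le> sqrt \<tau> * (L2_set (\<lambda>n. \<bar>r n\<bar>) {i..j} + L2_set (\<lambda>n. \<bar>s n\<bar>) {i..j})"
    using assms(1) by (intro mult_left_mono) auto
  then show ?thesis
    by (simp add: ell2_norm_L2_set algebra_simps)
qed

context
  fixes T \<tau> K :: real and N :: nat and g :: "nat \<Rightarrow> real \<Rightarrow> real"
    and W :: "'a::real_inner set" and X :: "nat \<Rightarrow> 'a"
  assumes X: "dominated_samples T \<tau> N g K W X"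
    and \<tau>: "0 < \<tau>" and N: "1 \<le> N" "real N * \<tau> \<le> T" and K: "0 \<le> K"
    and g_nonneg: "\<And>j t. 0 \<le> g j t"
    and g: "\<And>j. j \<le> 2 \<Longrightarrow> g j integrable_on {0..T}"
begin

lemma dominated_samples_test:
  assumes "w \<in> W"
  obtains u Z where "negligible Z" "time_derivative T (u 0) (u 1)" "time_derivative T (u 1) (u 2)"
    "\<And>n. n \<le> N \<Longrightarrow> inner (X n) w = u 0 (real n * \<tau>)"
    "\<And>j t. j \<le> 2 \<Longrightarrow> t \<in> {0..T} - Z \<Longrightarrow> \<bar>u (j::nat) t\<bar> \<le> K * norm w * g j t"
  using X assms unfolding dominated_samples_def by meson

lemma dominated_samples_closure:
  "subspace (closure W)" "\<And>n. n \<le> N \<Longrightarrow> X n \<in> closure W"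
  using X by (auto simp: dominated_samples_def intro: subspace_closure)

lemma Kg_integrable: "j \<le> 2 \<Longrightarrow> (\<lambda>t. c * g j t) integrable_on {0..T}"
  by (intro integrable_on_mult_right g)

lemma integral_g_nonneg: "0 \<le> integral S (g j)"
  by (cases "g j integrable_on S") (auto intro: integral_nonneg g_nonneg simp: not_integrable_integral)

lemma dominated_samples_value:
  assumes n: "n < N" "i = n \<or> i = n + 1"
  shows "\<tau> * norm (X i) \<le> K * (integral {real n * \<tau>..real (n + 1) * \<tau>} (g 0)
    + \<tau> * integral {real n * \<tau>..real (n + 1) * \<tau>} (g 1))"
proof -
  let ?I = "{real n * \<tau>..real (n + 1) * \<tau>}"
  note I = grid_cell_bounds[OF less_imp_le[OF \<tau>] N(2) n(1)]
  have "norm (\<tau> *\<^sub>R X i) \<le> K * (integral ?I (g 0) + \<tau> * integral ?I (g 1))"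
  proof (rule norm_le_of_dense_inner_le)
    show "\<tau> *\<^sub>R X i \<in> closure W"
      using n by (intro subspace_scale dominated_samples_closure) auto
    fix w assume "w \<in> W"
    then obtain u Z where u: "negligible Z" "time_derivative T (u 0) (u 1)" "time_derivative T (u 1) (u 2)"
      "\<And>n. n \<le> N \<Longrightarrow> inner (X n) w = u 0 (real n * \<tau>)"
      "\<And>j t. j \<le> 2 \<Longrightarrow> t \<in> {0..T} - Z \<Longrightarrow> \<bar>u (j::nat) t\<bar> \<le> K * norm w * g j t"
      by (rule dominated_samples_test) (rule that)
    have "(real (n + 1) * \<tau> - real n * \<tau>) * \<bar>u 0 (real i * \<tau>)\<bar>
        \<le> integral ?I (\<lambda>t. K * norm w * g 0 t)
          + (real (n + 1) * \<tau> - real n * \<tau>) * integral ?I (\<lambda>t. K * norm w * g 1 t)"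
      using I n(2) K g_nonneg
      by (intro time_derivative_value_le[OF u(2) u(1) u(5) Kg_integrable u(5) Kg_integrable]) auto
    moreover have "real (n + 1) * \<tau> - real n * \<tau> = \<tau>"
      by (simp add: algebra_simps)
    ultimately have "\<tau> * \<bar>inner (X i) w\<bar> \<le> K * norm w * integral ?I (g 0) + \<tau> * (K * norm w * integral ?I (g 1))"
      using n u(4)[of i] by auto
    moreover have "\<tau> * inner (X i) w \<le> \<tau> * \<bar>inner (X i) w\<bar>"
      using \<tau> by simp
    ultimately show "inner (\<tau> *\<^sub>R X i) w \<le> K * (integral ?I (g 0) + \<tau> * integral ?I (g 1)) * norm w"
      by (simp add: algebra_simps)
  qed (use K \<tau> integral_g_nonneg in auto)
  then show ?thesis using \<tau> by simp
qed

lemma dominated_samples_increment: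
  assumes n: "n < N"
  shows "\<tau> * norm (D_plus \<tau> X n) \<le> K * integral {real n * \<tau>..real (n + 1) * \<tau>} (g 1)"
proof -
  let ?I = "{real n * \<tau>..real (n + 1) * \<tau>}"
  note I = grid_cell_bounds[OF less_imp_le[OF \<tau>] N(2) n]
  have "norm (X (n + 1) - X n) \<le> K * integral ?I (g 1)"
  proof (rule norm_le_of_dense_inner_le)
    show "X (n + 1) - X n \<in> closure W"
      using n by (intro subspace_diff dominated_samples_closure) auto
    fix w assume "w \<in> W"
    then obtain u Z where u: "negligible Z" "time_derivative T (u 0) (u 1)" "time_derivative T (u 1) (u 2)"
      "\<And>n. n \<le> N \<Longrightarrow> inner (X n) w = u 0 (real n * \<tau>)"
      "\<And>j t. j \<le> 2 \<Longrightarrow> t \<in> {0..T} - Z \<Longrightarrow> \<bar>u (j::nat) t\<bar> \<le> K * norm w * g j t"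
      by (rule dominated_samples_test) (rule that)
    have "\<bar>u 0 (real (n + 1) * \<tau>) - u 0 (real n * \<tau>)\<bar> \<le> integral ?I (\<lambda>t. K * norm w * g 1 t)"
      using I by (intro time_derivative_increment_le[OF u(2) u(1) u(5) Kg_integrable]) auto
    then show "inner (X (n + 1) - X n) w \<le> K * integral ?I (g 1) * norm w"
      using u(4)[of n] u(4)[of "n + 1"] n by (simp add: inner_diff_left algebra_simps)
  qed (use K integral_g_nonneg in auto)
  then show ?thesis
    using \<tau> by (simp add: D_plus_def flip: mult.assoc)
qed

lemma dominated_samples_second_difference:
  assumes n: "1 \<le> n" "n < N"
  shows "\<tau> * norm (D_plus \<tau> (D_minus \<tau> X) n) \<le> K * (integral {real (n - 1) * \<tau>..real n * \<tau>} (g 2)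
    + integral {real n * \<tau>..real (n + 1) * \<tau>} (g 2))"
proof -
  have I: "0 \<le> real (n - 1) * \<tau>" "real (n - 1) * \<tau> \<le> real n * \<tau>"
    "real n * \<tau> \<le> real (n + 1) * \<tau>" "real (n + 1) * \<tau> \<le> T"
    using grid_cell_bounds[OF less_imp_le[OF \<tau>] N(2) n(2)] \<tau> by (auto intro: mult_right_mono)
  have steps: "real n * \<tau> - \<tau> = real (n - 1) * \<tau>" "real n * \<tau> + \<tau> = real (n + 1) * \<tau>"
    using n by (simp_all add: algebra_simps of_nat_diff)
  let ?J = "{real (n - 1) * \<tau>..real (n + 1) * \<tau>}"
  have "norm ((X (n + 1) - X n) - (X n - X (n - 1))) \<le> \<tau> * (K * integral ?J (g 2))"
  proof (rule norm_le_of_dense_inner_le)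
    show "(X (n + 1) - X n) - (X n - X (n - 1)) \<in> closure W"
      using n by (intro subspace_diff dominated_samples_closure) auto
    fix w assume "w \<in> W"
    then obtain u Z where u: "negligible Z" "time_derivative T (u 0) (u 1)" "time_derivative T (u 1) (u 2)"
      "\<And>n. n \<le> N \<Longrightarrow> inner (X n) w = u 0 (real n * \<tau>)"
      "\<And>j t. j \<le> 2 \<Longrightarrow> t \<in> {0..T} - Z \<Longrightarrow> \<bar>u (j::nat) t\<bar> \<le> K * norm w * g j t"
      by (rule dominated_samples_test) (rule that)
    have "\<bar>(u 0 (real n * \<tau> + \<tau>) - u 0 (real n * \<tau>)) - (u 0 (real n * \<tau>) - u 0 (real n * \<tau> - \<tau>))\<bar>
        \<le> \<tau> * integral {real n * \<tau> - \<tau>..real n * \<tau> + \<tau>} (\<lambda>t. K * norm w * g 2 t)"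
      using I \<tau> K g_nonneg steps
      by (intro time_derivative_second_difference_le[OF u(2,3) u(1) u(5) Kg_integrable]) auto
    then show "inner ((X (n + 1) - X n) - (X n - X (n - 1))) w \<le> \<tau> * (K * integral ?J (g 2)) * norm w"
      using u(4)[of n] u(4)[of "n + 1"] u(4)[of "n - 1"] n
      by (simp add: steps inner_diff_left algebra_simps)
  qed (use K \<tau> integral_g_nonneg in auto)
  moreover have "integral {real (n - 1) * \<tau>..real n * \<tau>} (g 2) + integral {real n * \<tau>..real (n + 1) * \<tau>} (g 2)
      = integral ?J (g 2)"
    using I by (intro Henstock_Kurzweil_Integration.integral_combine integrable_on_subinterval[OF g]) auto
  moreover have "\<tau> * norm (D_plus \<tau> (D_minus \<tau> X) n) = norm ((X (n + 1) - X n) - (X n - X (n - 1))) / \<tau>"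
  proof -
    have "D_plus \<tau> (D_minus \<tau> X) n = ((X (n + 1) - X n) - (X n - X (n - 1))) /\<^sub>R \<tau> /\<^sub>R \<tau>"
      by (simp add: D_plus_def D_minus_def scaleR_diff_right)
    then show ?thesis using \<tau> by (simp add: divide_inverse mult.commute flip: mult.assoc)
  qed
  ultimately show ?thesis
    using \<tau> by (simp add: pos_divide_le_eq mult.commute)
qed

context
  assumes g2: "\<And>j. j \<le> 2 \<Longrightarrow> (\<lambda>t. (g j t)\<^sup>2) integrable_on {0..T}"
begin

lemma ell2_norm_cell_means_le:
  assumes "j \<le> 2" "0 \<le> c"
  shows "ell2_norm \<tau> 0 (N - 1) (\<lambda>n. c / \<tau> * integral {real n * \<tau>..real (n + 1) * \<tau>} (g j))
    \<le> c * sqrt (integral {0..T} (\<lambda>t. (g j t)\<^sup>2))"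
  by (rule ell2_norm_le_of_cell_means[OF g[OF assms(1)] g2[OF assms(1)] \<tau> N(2,1) assms(2)])
     (use \<tau> assms(2) integral_g_nonneg in \<open>auto simp: abs_mult\<close>)

lemma ell2_norm_dominated_increments:
  "ell2_norm \<tau> 0 (N - 1) (D_plus \<tau> X) \<le> K * sqrt (integral {0..T} (\<lambda>t. (g 1 t)\<^sup>2))"
  by (rule ell2_norm_le_of_cell_means[OF g g2 \<tau> N(2,1) K dominated_samples_increment]) auto

text \<open>The window of a second difference consists of two cells; the triangle inequality separates them.\<close>

lemma ell2_norm_dominated_second_differences:
  "ell2_norm \<tau> 1 (N - 1) (D_plus \<tau> (D_minus \<tau> X)) \<le> 2 * K * sqrt (integral {0..T} (\<lambda>t. (g 2 t)\<^sup>2))"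
proof -
  define r where "r n = K / \<tau> * integral {real n * \<tau>..real (n + 1) * \<tau>} (g 2)" for n
  have r: "ell2_norm \<tau> 0 (N - 1) r \<le> K * sqrt (integral {0..T} (\<lambda>t. (g 2 t)\<^sup>2))"
    unfolding r_def using K by (intro ell2_norm_cell_means_le) auto
  have "ell2_norm \<tau> 1 (N - 1) (D_plus \<tau> (D_minus \<tau> X))
      \<le> ell2_norm \<tau> 1 (N - 1) (\<lambda>n. r (n - 1)) + ell2_norm \<tau> 1 (N - 1) r"
  proof (rule ell2_norm_triangle)
    fix n assume "1 \<le> n" "n \<le> N - 1"
    then have n: "1 \<le> n" "n < N" by auto
    from dominated_samples_second_difference[OF n]
    show "norm (D_plus \<tau> (D_minus \<tau> X) n) \<le> r (n - 1) + r n"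
      using \<tau> n by (simp add: r_def field_simps)
  qed (use \<tau> in simp)
  also have "ell2_norm \<tau> 1 (N - 1) (\<lambda>n. r (n - 1)) \<le> ell2_norm \<tau> 0 (N - 1) r"
  proof -
    have "(\<Sum>n=1..N - 1. (r (n - 1))\<^sup>2) = (\<Sum>n\<in>(\<lambda>n. n - 1) ` {1..N - 1}. (r n)\<^sup>2)"
      by (subst sum.reindex) (auto simp: inj_on_def)
    also have "\<dots> \<le> (\<Sum>n=0..N - 1. (r n)\<^sup>2)"
      by (intro sum_mono2) auto
    finally show ?thesis
      unfolding ell2_norm_def using \<tau> by simp
  qed
  also have "ell2_norm \<tau> 1 (N - 1) r \<le> ell2_norm \<tau> 0 (N - 1) r"
    using \<tau> by (intro ell2_norm_mono_range) auto
  finally show ?thesis using r by linarith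
qed

text \<open>There are \<open>N + 1\<close> grid points but \<open>N\<close> cells.  The last sample is controlled by the last cell a second
time, which doubles the square of the bound.\<close>

lemma ell2_norm_dominated_samples:
  "ell2_norm \<tau> 0 N X \<le> 2 * K * (sqrt (integral {0..T} (\<lambda>t. (g 0 t)\<^sup>2))
    + \<tau> * sqrt (integral {0..T} (\<lambda>t. (g 1 t)\<^sup>2)))"
proof -
  define r where "r n = K / \<tau> * integral {real n * \<tau>..real (n + 1) * \<tau>} (g 0)" for n
  \<comment> \<open>\<open>\<tau>\<close> is kept under the fraction so that \<open>s\<close>, like \<open>r\<close>, is a sequence of cell means\<close>
  define s where "s n = (K * \<tau>) / \<tau> * integral {real n * \<tau>..real (n + 1) * \<tau>} (g 1)" for n
  define A where "A = K * sqrt (integral {0..T} (\<lambda>t. (g 0 t)\<^sup>2)) + K * \<tau> * sqrt (integral {0..T} (\<lambda>t. (g 1 t)\<^sup>2))"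
  have "ell2_norm \<tau> 0 (N - 1) (\<lambda>n. r n + s n) \<le> ell2_norm \<tau> 0 (N - 1) r + ell2_norm \<tau> 0 (N - 1) s"
    by (rule ell2_norm_triangle)
       (use \<tau> K integral_g_nonneg in \<open>auto simp: r_def s_def intro!: add_nonneg_nonneg\<close>)
  also have "\<dots> \<le> A"
    unfolding r_def s_def A_def using K \<tau> by (intro add_mono ell2_norm_cell_means_le) auto
  finally have rs: "ell2_norm \<tau> 0 (N - 1) (\<lambda>n. r n + s n) \<le> A" .
  have A: "0 \<le> A"
    using rs ell2_norm_nonneg[of \<tau> 0 "N - 1" "\<lambda>n. r n + s n"] \<tau> by linarith
  have le: "norm (X i) \<le> r n + s n" if "n < N" "i = n \<or> i = n + 1" for i n
    using dominated_samples_value[OF that] \<tau> by (simp add: r_def s_def field_simps)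
  have "\<tau> * (\<Sum>n=0..N - 1. (r n + s n)\<^sup>2) \<le> A\<^sup>2"
    using rs A \<tau> by (simp add: ell2_norm_def real_sqrt_le_iff' sum_nonneg)
  moreover have "\<tau> * (\<Sum>n=0..N - 1. (norm (X n))\<^sup>2) \<le> \<tau> * (\<Sum>n=0..N - 1. (r n + s n)\<^sup>2)"
    using \<tau> N by (intro mult_left_mono sum_mono power_mono le) auto
  moreover have "\<tau> * (norm (X N))\<^sup>2 \<le> \<tau> * (\<Sum>n=0..N - 1. (r n + s n)\<^sup>2)"
  proof (rule mult_left_mono)
    have "(norm (X N))\<^sup>2 \<le> (r (N - 1) + s (N - 1))\<^sup>2"
      using N by (intro power_mono le) auto
    also have "\<dots> \<le> (\<Sum>n=0..N - 1. (r n + s n)\<^sup>2)"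
      by (rule member_le_sum) auto
    finally show "(norm (X N))\<^sup>2 \<le> (\<Sum>n=0..N - 1. (r n + s n)\<^sup>2)" .
  qed (use \<tau> in simp)
  moreover have "(\<Sum>n=0..N. (norm (X n))\<^sup>2) = (\<Sum>n=0..N - 1. (norm (X n))\<^sup>2) + (norm (X N))\<^sup>2"
    using N by (cases N) auto
  ultimately have "\<tau> * (\<Sum>n=0..N. (norm (X n))\<^sup>2) \<le> 2 * A\<^sup>2"
    by (simp add: distrib_left)
  also have "\<dots> \<le> (2 * A)\<^sup>2"
    by (simp add: power_mult_distrib)
  finally have "ell2_norm \<tau> 0 N X \<le> 2 * A"
    unfolding ell2_norm_def using A by (intro real_le_lsqrt) auto
  then show ?thesis
    by (simp add: A_def algebra_simps)
qed

end

end

lemma norm_dominated_samples_le: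
  assumes X: "dominated_samples T \<tau> N g K W X" and "0 < T" "0 \<le> \<tau>" "real N * \<tau> \<le> T" "0 \<le> K"
    and Z: "negligible Z"
    and M: "\<And>t. t \<in> {0..T} - Z \<Longrightarrow> g 0 t \<le> M0" "\<And>t. t \<in> {0..T} - Z \<Longrightarrow> g 1 t \<le> M1"
    and "0 \<le> M0" "0 \<le> M1" and n: "n \<le> N"
  shows "norm (X n) \<le> K * M0"
proof (rule norm_le_of_dense_inner_le)
  show "X n \<in> closure W"
    using X n by (simp add: dominated_samples_def)
  fix w assume "w \<in> W"
  then obtain u Z' where u: "negligible Z'" "time_derivative T (u 0) (u 1)" "time_derivative T (u 1) (u 2)"
    "\<And>n. n \<le> N \<Longrightarrow> inner (X n) w = u 0 (real n * \<tau>)"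
    "\<And>j t. j \<le> 2 \<Longrightarrow> t \<in> {0..T} - Z' \<Longrightarrow> \<bar>u (j::nat) t\<bar> \<le> K * norm w * g j t"
    using X unfolding dominated_samples_def by meson
  have Kw: "0 \<le> K * norm w" using assms by simp
  have "\<bar>u 0 (real n * \<tau>)\<bar> \<le> K * norm w * M0"
  proof (rule time_derivative_sup_le[OF \<open>0 < T\<close> u(2) negligible_Un[OF u(1) Z], of _ "K * norm w * M1"])
    show "\<bar>u 0 t\<bar> \<le> K * norm w * M0" if "t \<in> {0..T} - (Z' \<union> Z)" for t
      using u(5)[of 0 t] mult_left_mono[OF M(1) Kw, of t] that by force
    show "\<bar>u 1 t\<bar> \<le> K * norm w * M1" if "t \<in> {0..T} - (Z' \<union> Z)" for t
      using u(5)[of 1 t] mult_left_mono[OF M(2) Kw, of t] that by force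
    have "real n * \<tau> \<le> real N * \<tau>"
      using n assms by (intro mult_right_mono) auto
    then show "real n * \<tau> \<in> {0..T}"
      using assms by auto
  qed (use assms in auto)
  then show "inner (X n) w \<le> K * M0 * norm w"
    using u(4)[OF n] by (simp add: algebra_simps)
qed (use assms in auto)

lemma norm_D_plus_dominated_samples_le:
  assumes X: "dominated_samples T \<tau> N g K W X" and "0 < \<tau>" "1 \<le> N" "real N * \<tau> \<le> T" "0 \<le> K"
    and Z: "negligible Z" and M: "\<And>t. t \<in> {0..T} - Z \<Longrightarrow> g 1 t \<le> M1" and "0 \<le> M1"
    and g: "\<And>j t. 0 \<le> g j t" "\<And>j. j \<le> 2 \<Longrightarrow> g j integrable_on {0..T}" and n: "n < N"
  shows "norm (D_plus \<tau> X n) \<le> K * M1"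
proof -
  let ?I = "{real n * \<tau>..real (n + 1) * \<tau>}"
  have sub: "?I \<subseteq> {0..T}"
    using grid_cell_bounds[OF less_imp_le[OF assms(2)] assms(4) n] by auto
  have "\<tau> * norm (D_plus \<tau> X n) \<le> K * integral ?I (g 1)"
    using assms by (intro dominated_samples_increment[OF X]) auto
  also have "K * integral ?I (g 1) \<le> K * (\<tau> * M1)"
  proof (rule mult_left_mono)
    show "integral ?I (g 1) \<le> \<tau> * M1"
    proof (rule has_integral_le_off_negligible[OF _ _ Z])
      show "(g 1 has_integral integral ?I (g 1)) ?I"
        by (intro integrable_integral integrable_on_subinterval[OF g(2) sub]) auto
      show "((\<lambda>t. M1) has_integral \<tau> * M1) ?I"
        using has_integral_const_real[of M1 "real n * \<tau>" "real (n + 1) * \<tau>"] assms(2)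
        by (simp add: algebra_simps)
    qed (use M sub in auto)
  qed (use assms in simp)
  finally have "\<tau> * norm (D_plus \<tau> X n) \<le> \<tau> * (K * M1)"
    by (simp add: algebra_simps)
  then show ?thesis using assms by simp
qed

section \<open>The orthogonal projection\<close>

text \<open>One Gram-Schmidt step for every generator.\<close>

lemma orthogonal_projection_on_span_exists:
  fixes Y :: "'a::real_inner"
  assumes "finite B"
  shows "\<exists>p\<in>span B. \<forall>v\<in>span B. inner (Y - p) v = 0"
  using assms
proof (induction B arbitrary: Y)
  case empty
  then show ?case by simp
next
  case (insert a B)
  obtain p where p: "p \<in> span B" "\<And>v. v \<in> span B \<Longrightarrow> inner (Y - p) v = 0"
    using insert.IH by blast
  obtain q where q: "q \<in> span B" "\<And>v. v \<in> span B \<Longrightarrow> inner (a - q) v = 0"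
    using insert.IH by blast
  define z where "z = a - q"
  \<comment> \<open>for \<open>z = 0\<close> the quotient is \<open>0\<close>, which is then the right coefficient\<close>
  define P where "P = p + (inner (Y - p) z / inner z z) *\<^sub>R z"
  have sub: "span B \<subseteq> span (insert a B)" by (rule span_mono) auto
  have z: "z \<in> span (insert a B)"
    unfolding z_def using q(1) sub by (meson insertI1 span_base span_diff subsetD)
  have "inner (Y - P) v = 0" if v: "v \<in> span (insert a B)" for v
  proof -
    obtain k where k: "v - k *\<^sub>R a \<in> span B"
      using v by (auto simp: span_insert)
    have "v - k *\<^sub>R z = (v - k *\<^sub>R a) + k *\<^sub>R q"
      by (simp add: z_def scaleR_diff_right)
    then have w: "v - k *\<^sub>R z \<in> span B"
      using k q(1) by (metis span_add span_scale)
    have "inner (Y - P) (v - k *\<^sub>R z) = 0"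
      using p(2)[OF w] q(2)[OF w] by (simp add: P_def z_def[symmetric] inner_diff_left inner_add_left)
    moreover have "inner (Y - P) z = 0"
      by (simp add: P_def inner_diff_left inner_add_left)
    ultimately show ?thesis by (simp add: inner_diff_right)
  qed
  moreover have "P \<in> span (insert a B)"
    unfolding P_def using p(1) sub z by (intro span_add span_scale) auto
  ultimately show ?case by blast
qed

lemma L2_projection:
  fixes Y :: "'a::real_inner"
  assumes Vh: "Vh = span B" "finite B"
  shows L2_projection_in: "L2_projection Vh Y \<in> Vh"
    and L2_projection_orthogonal: "v \<in> Vh \<Longrightarrow> inner (Y - L2_projection Vh Y) v = 0"
proof -
  obtain p where p: "p \<in> Vh" "\<And>v. v \<in> Vh \<Longrightarrow> inner (Y - p) v = 0"
    using orthogonal_projection_on_span_exists[OF Vh(2), of Y] unfolding Vh(1)[symmetric] by blast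
  have unique: "q = p" if q: "q \<in> Vh" "\<And>v. v \<in> Vh \<Longrightarrow> inner (Y - q) v = 0" for q
  proof -
    have "p - q \<in> Vh"
      using p(1) q(1) Vh(1) by (simp add: span_diff)
    then have "inner (p - q) (p - q) = 0"
      using p(2)[of "p - q"] q(2)[of "p - q"] by (simp add: inner_diff_left)
    then show ?thesis by simp
  qed
  have "L2_projection Vh Y = p"
    unfolding L2_projection_def
  proof (rule the_equality)
    show "p \<in> Vh \<and> (\<forall>v\<in>Vh. inner (Y - p) v = 0)"
      using p by blast
  qed (rule unique, blast+)
  then show "L2_projection Vh Y \<in> Vh" "v \<in> Vh \<Longrightarrow> inner (Y - L2_projection Vh Y) v = 0"
    by (simp_all only: p)
qed

text \<open>Moves the projection to the test vector: the pairing with a projection error becomes the pairing of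
the unprojected function with a vector independent of time.\<close>

lemma inner_projection_error_swap:
  assumes "Vh = span B" "finite B"
  shows "inner (Y - L2_projection Vh Y) w = inner Y (w - L2_projection Vh w)"
proof -
  have "inner (Y - L2_projection Vh Y) (L2_projection Vh w) = 0"
    "inner (w - L2_projection Vh w) (L2_projection Vh Y) = 0"
    by (rule L2_projection_orthogonal[OF assms L2_projection_in[OF assms]])+
  then show ?thesis
    unfolding inner_diff_left inner_diff_right
    using inner_commute[of w "L2_projection Vh Y"]
      inner_commute[of "L2_projection Vh w" "L2_projection Vh Y"] by linarith
qed

section \<open>Passing from the evolution problem to sampled sequences\<close>

text \<open>The mesh covers a nonempty set, so it has a cell, and every cell contains a ball.\<close>

lemma mesh_size_pos:
  assumes "shape_regular_mesh \<sigma> \<Omega> h \<T>" "lipschitz_domain \<Omega>"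
  shows "0 < h"
proof -
  note mesh = assms(1)[unfolded shape_regular_mesh_def]
  have fin: "finite \<T>" using mesh by (elim conjE)
  have cover: "\<Union>\<T> = closure \<Omega>" using mesh by (elim conjE)
  have h: "h = Max (diameter ` \<T>)" using mesh by (elim conjE)
  have balls: "\<forall>K\<in>\<T>. \<exists>x \<rho>. 0 < \<rho> \<and> ball x \<rho> \<subseteq> K \<and> diameter K \<le> \<sigma> * \<rho>"
    using mesh by (elim conjE)
  have "\<Union>\<T> \<noteq> {}" and bdd: "bounded (\<Union>\<T>)"
    using cover assms(2) by (auto simp: lipschitz_domain_def)
  then obtain K where K: "K \<in> \<T>" by blast
  obtain x \<rho> where \<rho>: "0 < \<rho>" "ball x \<rho> \<subseteq> K"
    using balls K by blast
  let ?y = "x + (\<rho> / 2) *\<^sub>R axis undefined 1"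
  have "dist x ?y = \<rho> / 2"
    using \<rho>(1) by (simp add: dist_norm)
  moreover have "dist x ?y \<le> diameter K"
  proof (rule diameter_bounded_bound)
    show "bounded K" using bdd K by (meson Union_upper bounded_subset)
    show "x \<in> K" "?y \<in> K"
      using \<rho> calculation by (auto intro!: subsetD[OF \<rho>(2)])
  qed
  moreover have "diameter K \<le> h"
    using fin K unfolding h by simp
  ultimately show ?thesis using \<rho>(1) by linarith
qed

lemma AE_lebesgue_on_negligible:
  assumes "AE t in lebesgue_on {0<..<T::real}. P t"
  obtains Z where "negligible Z" "\<And>t. t \<in> {0..T} - Z \<Longrightarrow> P t"
proof -
  have "AE t in lebesgue. t \<in> {0<..<T} \<longrightarrow> P t"
    using assms by (subst (asm) AE_restrict_space_iff) auto
  then obtain Z where Z: "{t \<in> space lebesgue. \<not> (t \<in> {0<..<T} \<longrightarrow> P t)} \<subseteq> Z"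
    "emeasure lebesgue Z = 0" "Z \<in> sets lebesgue"
    by (rule AE_E)
  show ?thesis
  proof (rule that)
    have "negligible Z"
      using Z(2,3) unfolding negligible_iff_null_sets by (intro null_setsI)
    then show "negligible (insert 0 (insert T Z))"
      by (simp only: negligible_insert)
    show "P t" if t: "t \<in> {0..T} - insert 0 (insert T Z)" for t
    proof (rule ccontr)
      assume "\<not> P t"
      moreover have "t \<in> {0<..<T}"
        using t by simp
      ultimately show False
        using Z(1) t by (simp add: subset_iff)
    qed
  qed
qed

lemma time_derivative_inner:
  assumes "time_derivative T u u'"
  shows "time_derivative T (\<lambda>t. inner (u t) z) (\<lambda>t. inner (u' t) z)"
  unfolding time_derivative_def
proof (intro allI impI)
  fix a b assume "0 \<le> a \<and> a \<le> b \<and> b \<le> T"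
  then have "(u' has_integral (u b - u a)) {a..b}"
    using assms by (simp add: time_derivative_def)
  from has_integral_linear[OF this bounded_linear_inner_left[of z]]
  show "((\<lambda>t. inner (u' t) z) has_integral inner (u b) z - inner (u a) z) {a..b}"
    by (simp add: o_def inner_diff_left)
qed

lemma sobolev_norm_nonneg: "0 \<le> sobolev_norm \<Omega> r u"
  by (simp add: sobolev_norm_def sum_nonneg)

lemma L2_time_integrable:
  assumes u: "u \<in> L2_time T \<Omega> r"
  shows "(\<lambda>t. sobolev_norm \<Omega> r (u t)) integrable_on {0..T}"
    and "(\<lambda>t. (sobolev_norm \<Omega> r (u t))\<^sup>2) integrable_on {0..T}"
    and "sqrt (integral {0..T} (\<lambda>t. (sobolev_norm \<Omega> r (u t))\<^sup>2)) = L2_time_norm T \<Omega> r u"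
proof -
  let ?s = "\<lambda>t. sobolev_norm \<Omega> r (u t)"
  have sq: "integrable (lebesgue_on {0<..<T}) (\<lambda>t. (?s t)\<^sup>2)"
    using u by (simp add: L2_time_def)
  then have "(\<lambda>t. sqrt ((?s t)\<^sup>2)) \<in> borel_measurable (lebesgue_on {0<..<T})"
    by (intro measurable_compose[OF _ borel_measurable_sqrt] borel_measurable_integrable)
  then have meas: "?s \<in> borel_measurable (lebesgue_on {0<..<T})"
    by (simp add: sobolev_norm_nonneg)
  interpret finite_measure "lebesgue_on {0<..<T}"
    by (rule finite_measure_lebesgue_on) simp
  have "integrable (lebesgue_on {0<..<T}) ?s"
    by (rule square_integrable_imp_integrable[OF meas sq])
  then have "?s integrable_on {0<..<T}"
    by (rule integrable_on_lebesgue_on) simp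
  then show "?s integrable_on {0..T}"
    by (simp add: integrable_on_Icc_iff_Ioo)
  have "(\<lambda>t. (?s t)\<^sup>2) integrable_on {0<..<T}"
    using sq by (rule integrable_on_lebesgue_on) simp
  then show "(\<lambda>t. (?s t)\<^sup>2) integrable_on {0..T}"
    by (simp add: integrable_on_Icc_iff_Ioo)
  show "sqrt (integral {0..T} (\<lambda>t. (?s t)\<^sup>2)) = L2_time_norm T \<Omega> r u"
    using lebesgue_integral_eq_integral[OF sq]
    by (simp add: L2_time_norm_def integral_open_interval_real)
qed

text \<open>Nonnegativity is part of the conclusion because it rests on \<open>T > 0\<close>: over a null interval the
essential supremum would be \<open>-\<infinity>\<close>.\<close>

lemma Linf_time_bound:
  assumes u: "u \<in> Linf_time T \<Omega> r" and T: "0 < T"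
  obtains Z where "negligible Z"
    "\<And>t. t \<in> {0..T} - Z \<Longrightarrow> sobolev_norm \<Omega> r (u t) \<le> Linf_time_norm T \<Omega> r u"
    "0 \<le> Linf_time_norm T \<Omega> r u"
proof -
  let ?E = "esssup (lebesgue_on {0<..<T}) (\<lambda>t. ereal (sobolev_norm \<Omega> r (u t)))"
  obtain Z where Z: "negligible Z" "\<And>t. t \<in> {0..T} - Z \<Longrightarrow> ereal (sobolev_norm \<Omega> r (u t)) \<le> ?E"
    using AE_lebesgue_on_negligible[OF esssup_AE[where M = "lebesgue_on {0<..<T}"
        and f = "\<lambda>t. ereal (sobolev_norm \<Omega> r (u t))"]] by blast
  have "\<not> {0..T} \<subseteq> Z"
    using T Z(1) negligible_subset[of Z "{0..T}"] negligible_interval(1)[of 0 T] by auto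
  then obtain t where "t \<in> {0..T} - Z" by blast
  from Z(2)[OF this] have E0: "0 \<le> ?E"
    using sobolev_norm_nonneg by (metis ereal_less_eq(5) order_trans)
  moreover have "?E < \<infinity>"
    using u by (simp add: Linf_time_def)
  ultimately have "ereal (real_of_ereal ?E) = ?E"
    by (intro ereal_real') auto
  then have E: "ereal (Linf_time_norm T \<Omega> r u) = ?E"
    by (simp add: Linf_time_norm_def)
  show ?thesis
  proof (rule that[OF Z(1)])
    show "sobolev_norm \<Omega> r (u t) \<le> Linf_time_norm T \<Omega> r u" if "t \<in> {0..T} - Z" for t
      using Z(2)[OF that] unfolding E[symmetric] by simp
    show "0 \<le> Linf_time_norm T \<Omega> r u"
      using E0 unfolding E[symmetric] by simp
  qed
qed

lemma skew_systemD:
  assumes "skew_system \<Omega> \<V> G"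
  shows "lipschitz_domain \<Omega>" "subspace \<V>" "L2_on \<Omega> \<subseteq> closure \<V>"
    "\<And>u v. u \<in> \<V> \<Longrightarrow> v \<in> \<V> \<Longrightarrow> G (u + v) = G u + G v"
    "\<And>u c. u \<in> \<V> \<Longrightarrow> G (c *\<^sub>R u) = c *\<^sub>R G u"
    "\<And>u. u \<in> \<V> \<Longrightarrow> G u \<in> L2_on \<Omega>"
    "\<And>u v. u \<in> \<V> \<Longrightarrow> v \<in> \<V> \<Longrightarrow> inner (G u) v = - inner u (G v)"
proof -
  note system = assms[unfolded skew_system_def first_order_operator_def]
  show "lipschitz_domain \<Omega>" using system by (elim conjE)
  show "subspace \<V>" using system by (elim conjE)
  show "L2_on \<Omega> \<subseteq> closure \<V>" using system by (elim conjE)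
  have lin: "\<forall>u\<in>\<V>. \<forall>v\<in>\<V>. \<forall>c. G (u + v) = G u + G v \<and> G (c *\<^sub>R u) = c *\<^sub>R G u"
    using system by (elim conjE)
  show "G (u + v) = G u + G v" if "u \<in> \<V>" "v \<in> \<V>" for u v
    using lin that by blast
  show "G (c *\<^sub>R u) = c *\<^sub>R G u" if "u \<in> \<V>" for u c
    using lin that by blast
  have "G ` \<V> \<subseteq> L2_on \<Omega>" using system by (elim conjE)
  then show "G u \<in> L2_on \<Omega>" if "u \<in> \<V>" for u
    using that by (rule subsetD[OF _ imageI])
  have "\<forall>u\<in>\<V>. \<forall>v\<in>\<V>. inner (G u) v = - inner u (G v)" using system by (elim conjE)
  then show "inner (G u) v = - inner u (G v)" if "u \<in> \<V>" "v \<in> \<V>" for u v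
    using that by blast
qed

lemma good_times:
  assumes exact: "exact_solution \<Omega> \<V> G T r F U0 U"
    and appr: "\<forall>j\<le>2. AE t in lebesgue_on {0<..<T}. approximation_estimate Vh G c h r nrm (U j t)"
  obtains Z where "negligible Z"
    "\<And>j t. j \<le> 2 \<Longrightarrow> t \<in> {0..T} - Z \<Longrightarrow> approximation_estimate Vh G c h r nrm (U j t)"
    "\<And>j t. j \<le> 2 \<Longrightarrow> t \<in> {0..T} - Z \<Longrightarrow> U j t \<in> \<V>"
proof -
  have "AE t in lebesgue_on {0<..<T}. \<forall>j\<in>{..2}. approximation_estimate Vh G c h r nrm (U j t) \<and> U j t \<in> \<V>"
    using exact appr by (subst AE_ball_countable) (auto simp: exact_solution_def)
  then obtain Z where "negligible Z"
    "\<And>t. t \<in> {0..T} - Z \<Longrightarrow> \<forall>j\<in>{..2}. approximation_estimate Vh G c h r nrm (U j t) \<and> U j t \<in> \<V>"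
    by (rule AE_lebesgue_on_negligible) (rule that)
  then show ?thesis by (intro that[of Z]) auto
qed

text \<open>It suffices that the pairing of \<open>X n\<close> with \<open>w\<close> is that of the function \<open>U 0\<close> with a vector \<open>z w\<close>
independent of time; differentiation in time then passes to \<open>U 1\<close> and \<open>U 2\<close>.\<close>

lemma dominated_samplesI:
  assumes "subspace W" "\<And>n. n \<le> N \<Longrightarrow> X n \<in> closure W" "negligible Z"
    and "time_derivative T (U 0) (U 1)" "time_derivative T (U 1) (U 2)"
    and test: "\<And>n w. n \<le> N \<Longrightarrow> w \<in> W \<Longrightarrow> inner (X n) w = inner (U 0 (real n * \<tau>)) (z w)"
    and bound: "\<And>w j t. w \<in> W \<Longrightarrow> j \<le> 2 \<Longrightarrow> t \<in> {0..T} - Z \<Longrightarrow>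
      \<bar>inner (U (j::nat) t) (z w)\<bar> \<le> K * norm w * g j t"
  shows "dominated_samples T \<tau> N g K W X"
  unfolding dominated_samples_def
proof (intro conjI ballI)
  show "subspace W" "\<forall>n\<le>N. X n \<in> closure W"
    using assms(1,2) by auto
  fix w assume w: "w \<in> W"
  show "\<exists>u Z. negligible Z \<and> time_derivative T (u 0) (u 1) \<and> time_derivative T (u 1) (u 2) \<and>
      (\<forall>n\<le>N. inner (X n) w = u 0 (real n * \<tau>)) \<and>
      (\<forall>j\<le>2. \<forall>t\<in>{0..T} - Z. \<bar>u (j::nat) t\<bar> \<le> K * norm w * g j t)"
  proof (rule exI[of _ "\<lambda>j t. inner (U j t) (z w)"], rule exI[of _ Z], intro conjI allI impI ballI)
    show "time_derivative T (\<lambda>t. inner (U 0 t) (z w)) (\<lambda>t. inner (U 1 t) (z w))"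
      "time_derivative T (\<lambda>t. inner (U 1 t) (z w)) (\<lambda>t. inner (U 2 t) (z w))"
      using assms(4,5) by (auto intro: time_derivative_inner)
  qed (use assms(3) test bound w in auto)
qed

lemma grid_point_in_time_interval:
  assumes "n \<le> N" "0 < \<tau>" "real N * \<tau> \<le> T"
  shows "real n * \<tau> \<in> {0..T}"
proof -
  have "real n * \<tau> \<le> real N * \<tau>"
    using assms by (intro mult_right_mono) auto
  also note assms(3)
  finally show ?thesis using assms by simp
qed

lemma projection_error_in:
  assumes "subspace \<V>" "Vh = span B" "finite B" "Vh \<subseteq> \<V>" "Y \<in> \<V>"
  shows "Y - L2_projection Vh Y \<in> \<V>"
  using assms L2_projection_in[OF assms(2,3), of Y] by (auto intro: subspace_diff)

context
  fixes \<Omega> :: "(real^'d) set" and \<V> Vh B :: "('d, 'm::finite) L2 set"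
    and G :: "('d, 'm) L2 \<Rightarrow> ('d, 'm) L2" and T r c h \<tau> :: real and N :: nat
    and F :: "real \<Rightarrow> ('d, 'm) L2" and U :: "nat \<Rightarrow> real \<Rightarrow> ('d, 'm) L2" and U0
  assumes system: "skew_system \<Omega> \<V> G" and exact: "exact_solution \<Omega> \<V> G T r F U0 U"
    and appr: "\<forall>j\<le>2. AE t in lebesgue_on {0<..<T}.
      approximation_estimate Vh G c h r (sobolev_norm \<Omega> r) (U j t)"
    and Vh: "Vh = span B" "finite B" "Vh \<subseteq> \<V>"
    and pos: "0 < h" "0 < \<tau>" "real N * \<tau> \<le> T"
begin

lemma solution_derivatives:
  "time_derivative T (U 0) (U 1)" "time_derivative T (U 1) (U 2)"
  using exact by (auto simp: exact_solution_def)

lemma projection_error_dominated: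
  "dominated_samples T \<tau> N (\<lambda>j t. sobolev_norm \<Omega> r (U j t)) (c * h powr r) UNIV
    (\<lambda>n. U 0 (real n * \<tau>) - L2_projection Vh (U 0 (real n * \<tau>)))"
proof (rule good_times[OF exact appr])
  fix Z assume Z: "negligible Z"
    "\<And>j t. j \<le> 2 \<Longrightarrow> t \<in> {0..T} - Z \<Longrightarrow> approximation_estimate Vh G c h r (sobolev_norm \<Omega> r) (U j t)"
  note swap = inner_projection_error_swap[OF Vh(1,2)]
  have bound: "\<bar>inner (U j t) (w - L2_projection Vh w)\<bar> \<le> c * h powr r * norm w * sobolev_norm \<Omega> r (U j t)"
    if jt: "j \<le> 2" "t \<in> {0..T} - Z" for w j t
  proof -
    have "0 \<le> h * norm (G (U j t - L2_projection Vh (U j t)))"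
      using pos(1) by simp
    then have "norm (U j t - L2_projection Vh (U j t)) \<le> c * h powr r * sobolev_norm \<Omega> r (U j t)"
      using Z(2)[OF jt] unfolding approximation_estimate_def by linarith
    then have "norm (U j t - L2_projection Vh (U j t)) * norm w \<le> c * h powr r * sobolev_norm \<Omega> r (U j t) * norm w"
      by (rule mult_right_mono) simp
    moreover have "\<bar>inner (U j t) (w - L2_projection Vh w)\<bar> \<le> norm (U j t - L2_projection Vh (U j t)) * norm w"
      using Cauchy_Schwarz_ineq2[of "U j t - L2_projection Vh (U j t)" w] by (simp only: swap)
    ultimately show ?thesis by (simp only: mult_ac)
  qed
  show ?thesis
    by (rule dominated_samplesI[where z = "\<lambda>w. w - L2_projection Vh w", OF _ _ Z(1) solution_derivatives swap bound])
      auto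
qed

text \<open>Skew-symmetry gives \<open>(G (Y - \<Pi> Y), w) = - (Y - \<Pi> Y, G w) = - (Y, G w - \<Pi> G w)\<close>.  The last expression is
defined for every \<open>Y\<close> and is a continuous linear functional of \<open>Y\<close>.\<close>

lemma G_projection_error_dominated:
  "dominated_samples T \<tau> N (\<lambda>j t. sobolev_norm \<Omega> r (U j t)) (c * h powr (r - 1)) \<V>
    (\<lambda>n. G (U 0 (real n * \<tau>) - L2_projection Vh (U 0 (real n * \<tau>))))"
proof (rule good_times[OF exact appr])
  fix Z assume Z: "negligible Z"
    "\<And>j t. j \<le> 2 \<Longrightarrow> t \<in> {0..T} - Z \<Longrightarrow> approximation_estimate Vh G c h r (sobolev_norm \<Omega> r) (U j t)"
    "\<And>j t. j \<le> 2 \<Longrightarrow> t \<in> {0..T} - Z \<Longrightarrow> U j t \<in> \<V>"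
  let ?z = "\<lambda>w. - (G w - L2_projection Vh (G w))"
  have swap: "inner (G (Y - L2_projection Vh Y)) w = inner Y (?z w)" if Y: "Y \<in> \<V>" and w: "w \<in> \<V>" for Y w
  proof -
    have "inner (G (Y - L2_projection Vh Y)) w = - inner (Y - L2_projection Vh Y) (G w)"
      by (rule skew_systemD(7)[OF system projection_error_in[OF skew_systemD(2)[OF system] Vh Y] w])
    also have "\<dots> = inner Y (?z w)"
      by (simp only: inner_projection_error_swap[OF Vh(1,2)] inner_minus_right)
    finally show ?thesis .
  qed
  have bound: "\<bar>inner (U j t) (?z w)\<bar> \<le> c * h powr (r - 1) * norm w * sobolev_norm \<Omega> r (U j t)"
    if w: "w \<in> \<V>" and jt: "j \<le> 2" "t \<in> {0..T} - Z" for w j t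
  proof -
    let ?e = "U j t - L2_projection Vh (U j t)"
    have "h * norm (G ?e) \<le> c * h powr r * sobolev_norm \<Omega> r (U j t)"
      using Z(2)[OF jt] norm_ge_zero[of ?e] unfolding approximation_estimate_def by linarith
    also have "h powr r = h * h powr (r - 1)"
      using pos(1) by (simp add: powr_diff)
    finally have "h * norm (G ?e) \<le> h * (c * h powr (r - 1) * sobolev_norm \<Omega> r (U j t))"
      by (simp only: mult_ac)
    then have "norm (G ?e) \<le> c * h powr (r - 1) * sobolev_norm \<Omega> r (U j t)"
      using pos(1) by (simp only: mult_le_cancel_left_pos)
    then have "norm (G ?e) * norm w \<le> c * h powr (r - 1) * sobolev_norm \<Omega> r (U j t) * norm w"
      by (rule mult_right_mono) simp
    moreover have "\<bar>inner (U j t) (?z w)\<bar> \<le> norm (G ?e) * norm w"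
      using Cauchy_Schwarz_ineq2[of "G ?e" w] by (simp only: swap[OF Z(3)[OF jt] w])
    ultimately show ?thesis by (simp only: mult_ac)
  qed
  have in_V: "U 0 (real n * \<tau>) \<in> \<V>" if "n \<le> N" for n
    using exact grid_point_in_time_interval[OF that pos(2,3)] by (simp only: exact_solution_def)
  show ?thesis
  proof (rule dominated_samplesI[where z = ?z, OF skew_systemD(2)[OF system] _ Z(1) solution_derivatives _ bound])
    show "G (U 0 (real n * \<tau>) - L2_projection Vh (U 0 (real n * \<tau>))) \<in> closure \<V>" if "n \<le> N" for n
      by (rule subsetD[OF skew_systemD(3)[OF system] skew_systemD(6)[OF system projection_error_in[OF skew_systemD(2)[OF system] Vh in_V[OF that]]]])
    show "inner (G (U 0 (real n * \<tau>) - L2_projection Vh (U 0 (real n * \<tau>)))) w = inner (U 0 (real n * \<tau>)) (?z w)"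
      if "n \<le> N" "w \<in> \<V>" for n w
      by (rule swap[OF in_V[OF that(1)] that(2)])
  qed
qed

end

lemma N_norm_bounds:
  assumes exact: "exact_solution \<Omega> \<V> G T r F U0 U" and T: "0 < T"
  shows "\<And>j. j \<le> 2 \<Longrightarrow> L2_time_norm T \<Omega> r (U j) \<le> N_norm T \<Omega> r U"
    and "\<And>j. j \<le> 1 \<Longrightarrow> Linf_time_norm T \<Omega> r (U j) \<le> N_norm T \<Omega> r U"
    and "L2_time_norm T \<Omega> r (U 0) + L2_time_norm T \<Omega> r (U 1) \<le> N_norm T \<Omega> r U"
proof -
  have L2: "0 \<le> L2_time_norm T \<Omega> r (U j)" for j
    by (simp add: L2_time_norm_def)
  have Linf: "0 \<le> Linf_time_norm T \<Omega> r (U j)" if "j \<le> 1" for j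
  proof -
    have "U j \<in> Linf_time T \<Omega> r" using exact that by (simp add: exact_solution_def)
    then show ?thesis using T by (rule Linf_time_bound)
  qed
  have eq: "N_norm T \<Omega> r U = L2_time_norm T \<Omega> r (U 0) + L2_time_norm T \<Omega> r (U 1) + L2_time_norm T \<Omega> r (U 2)
      + (Linf_time_norm T \<Omega> r (U 0) + Linf_time_norm T \<Omega> r (U 1))"
    by (simp add: N_norm_def numeral_2_eq_2)
  have nonneg: "0 \<le> L2_time_norm T \<Omega> r (U 0)" "0 \<le> L2_time_norm T \<Omega> r (U 1)" "0 \<le> L2_time_norm T \<Omega> r (U 2)"
    "0 \<le> Linf_time_norm T \<Omega> r (U 0)" "0 \<le> Linf_time_norm T \<Omega> r (U 1)"
    using L2 Linf by auto
  show "L2_time_norm T \<Omega> r (U j) \<le> N_norm T \<Omega> r U" if "j \<le> 2" for j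
  proof -
    from that have "j = 0 \<or> j = 1 \<or> j = 2" by auto
    then show ?thesis using nonneg eq by auto
  qed
  show "Linf_time_norm T \<Omega> r (U j) \<le> N_norm T \<Omega> r U" if "j \<le> 1" for j
  proof -
    from that have "j = 0 \<or> j = 1" by auto
    then show ?thesis using nonneg eq by auto
  qed
  show "L2_time_norm T \<Omega> r (U 0) + L2_time_norm T \<Omega> r (U 1) \<le> N_norm T \<Omega> r U"
    using nonneg eq by linarith
qed

text \<open>Dominating functions are the \<open>H\<^sup>r\<close> norms of \<open>\<partial>\<^sub>t\<^sup>j U\<close>.  The step bound \<open>\<tau>max\<close> enters through the
sampled norm of the projection error, in which the derivative carries a factor \<open>\<tau>\<close>.\<close>

lemma projection_error_sample_bounds:
  fixes \<Omega> :: "(real^'d) set" and \<V> Vh B :: "('d, 'm::finite) L2 set"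
  assumes system: "skew_system \<Omega> \<V> G" and exact: "exact_solution \<Omega> \<V> G T r F U0 U"
    and appr: "\<forall>j\<le>2. AE t in lebesgue_on {0<..<T}.
      approximation_estimate Vh G c h r (sobolev_norm \<Omega> r) (U j t)"
    and Vh: "Vh = span B" "finite B" "Vh \<subseteq> \<V>"
    and pos: "0 < h" "0 < \<tau>" "real N * \<tau> \<le> T" and T: "0 < T" and N: "1 \<le> N" and c: "0 \<le> c"
    and \<tau>max: "\<tau> \<le> \<tau>max"
    and y: "y = (\<lambda>n. U 0 (real n * \<tau>) - L2_projection Vh (U 0 (real n * \<tau>)))"
  defines "A \<equiv> 2 * (1 + \<bar>\<tau>max\<bar>) * c * N_norm T \<Omega> r U"
  shows "ell2_norm \<tau> 0 N y \<le> h powr r * A"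
    and "ell2_norm \<tau> 0 (N - 1) (D_plus \<tau> y) \<le> h powr r * A"
    and "n \<le> N \<Longrightarrow> norm (G (y n)) \<le> h powr (r - 1) * A"
    and "n < N \<Longrightarrow> norm (D_plus \<tau> (\<lambda>i. G (y i)) n) \<le> h powr (r - 1) * A"
    and "ell2_norm \<tau> 0 (N - 1) (D_plus \<tau> (\<lambda>i. G (y i))) \<le> h powr (r - 1) * A"
    and "ell2_norm \<tau> 1 (N - 1) (D_plus \<tau> (D_minus \<tau> (\<lambda>i. G (y i)))) \<le> h powr (r - 1) * A"
proof -
  define g where "g = (\<lambda>j t. sobolev_norm \<Omega> r (U j t))"
  let ?M = "N_norm T \<Omega> r U"
  have L2: "U j \<in> L2_time T \<Omega> r" if "j \<le> 2" for j
    using exact that by (simp add: exact_solution_def)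
  have Linf: "U j \<in> Linf_time T \<Omega> r" if "j \<le> 1" for j
    using exact that by (simp add: exact_solution_def)
  have g: "\<And>j t. 0 \<le> g j t" "\<And>j. j \<le> 2 \<Longrightarrow> g j integrable_on {0..T}"
    "\<And>j. j \<le> 2 \<Longrightarrow> (\<lambda>t. (g j t)\<^sup>2) integrable_on {0..T}"
    using L2_time_integrable[OF L2] by (simp_all add: g_def sobolev_norm_nonneg)
  have L2_norm: "sqrt (integral {0..T} (\<lambda>t. (g j t)\<^sup>2)) = L2_time_norm T \<Omega> r (U j)" if "j \<le> 2" for j
    using L2_time_integrable(3)[OF L2[OF that]] by (simp add: g_def)
  note M = N_norm_bounds[OF exact T]
  obtain Z0 where Z0: "negligible Z0" "\<And>t. t \<in> {0..T} - Z0 \<Longrightarrow> g 0 t \<le> Linf_time_norm T \<Omega> r (U 0)"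
    "0 \<le> Linf_time_norm T \<Omega> r (U 0)"
    unfolding g_def using Linf_time_bound[OF Linf[of 0] T] by auto
  obtain Z1 where Z1: "negligible Z1" "\<And>t. t \<in> {0..T} - Z1 \<Longrightarrow> g 1 t \<le> Linf_time_norm T \<Omega> r (U 1)"
    "0 \<le> Linf_time_norm T \<Omega> r (U 1)"
    unfolding g_def using Linf_time_bound[OF Linf[of 1] T] by auto
  have M0: "0 \<le> ?M"
    using Z0(3) M(2)[of 0] by simp
  have A: "c * ?M \<le> A" "2 * (c * ?M) \<le> A" "2 * c * ((1 + \<bar>\<tau>max\<bar>) * ?M) = A"
  proof -
    have "0 \<le> \<bar>\<tau>max\<bar> * (c * ?M)" using c M0 by simp
    then show "c * ?M \<le> A" "2 * (c * ?M) \<le> A" "2 * c * ((1 + \<bar>\<tau>max\<bar>) * ?M) = A"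
      using c M0 unfolding A_def by (simp_all add: algebra_simps)
  qed
  have scaled: "c * h powr p * x \<le> h powr p * A" if "x \<le> ?M" for x p
  proof -
    have "h powr p * (c * x) \<le> h powr p * (c * ?M)"
      using that c by (intro mult_left_mono) auto
    also have "\<dots> \<le> h powr p * A"
      using A(1) by (intro mult_left_mono) auto
    finally show ?thesis by (simp add: mult_ac)
  qed
  have y_dom: "dominated_samples T \<tau> N g (c * h powr r) UNIV y"
    unfolding y g_def by (rule projection_error_dominated[OF system exact appr Vh pos])
  have x_dom: "dominated_samples T \<tau> N g (c * h powr (r - 1)) \<V> (\<lambda>i. G (y i))"
    unfolding y g_def by (rule G_projection_error_dominated[OF system exact appr Vh pos])
  have K: "0 \<le> c * h powr p" for p using c by simp
  have "ell2_norm \<tau> 0 N y \<le> 2 * (c * h powr r) * (L2_time_norm T \<Omega> r (U 0) + \<tau> * L2_time_norm T \<Omega> r (U 1))"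
    using ell2_norm_dominated_samples[OF y_dom pos(2) N pos(3) K g] L2_norm by simp
  also have "\<dots> \<le> 2 * (c * h powr r) * ((1 + \<bar>\<tau>max\<bar>) * ?M)"
  proof (rule mult_left_mono)
    have L1: "0 \<le> L2_time_norm T \<Omega> r (U 1)" "0 \<le> L2_time_norm T \<Omega> r (U 0)"
      by (simp_all add: L2_time_norm_def)
    have "L2_time_norm T \<Omega> r (U 0) + \<tau> * L2_time_norm T \<Omega> r (U 1)
        \<le> (1 + \<bar>\<tau>max\<bar>) * L2_time_norm T \<Omega> r (U 0) + (1 + \<bar>\<tau>max\<bar>) * L2_time_norm T \<Omega> r (U 1)"
      using L1 \<tau>max by (intro add_mono mult_right_mono) (auto simp: algebra_simps)
    also have "\<dots> \<le> (1 + \<bar>\<tau>max\<bar>) * ?M"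
      using M(3) by (simp add: mult_left_mono flip: distrib_left)
    finally show "L2_time_norm T \<Omega> r (U 0) + \<tau> * L2_time_norm T \<Omega> r (U 1) \<le> (1 + \<bar>\<tau>max\<bar>) * ?M" .
  qed (use K in simp)
  also have "\<dots> = h powr r * A"
    unfolding A(3)[symmetric] by (simp add: mult_ac)
  finally show "ell2_norm \<tau> 0 N y \<le> h powr r * A" .
  show "ell2_norm \<tau> 0 (N - 1) (D_plus \<tau> y) \<le> h powr r * A"
    using ell2_norm_dominated_increments[OF y_dom pos(2) N pos(3) K g] L2_norm[of 1] scaled[OF M(1), of 1 r] by simp
  show "ell2_norm \<tau> 0 (N - 1) (D_plus \<tau> (\<lambda>i. G (y i))) \<le> h powr (r - 1) * A"
    using ell2_norm_dominated_increments[OF x_dom pos(2) N pos(3) K g] L2_norm[of 1] scaled[OF M(1), of 1 "r - 1"] by simp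
  show "norm (G (y n)) \<le> h powr (r - 1) * A" if n: "n \<le> N"
  proof -
    have "norm (G (y n)) \<le> c * h powr (r - 1) * Linf_time_norm T \<Omega> r (U 0)"
      using pos Z0 Z1 by (intro norm_dominated_samples_le[OF x_dom T _ _ K negligible_Un[OF Z0(1) Z1(1)] _ _ Z0(3) Z1(3) n]) auto
    also have "\<dots> \<le> h powr (r - 1) * A"
      by (intro scaled M(2)) simp
    finally show ?thesis .
  qed
  show "norm (D_plus \<tau> (\<lambda>i. G (y i)) n) \<le> h powr (r - 1) * A" if n: "n < N"
  proof -
    have "norm (D_plus \<tau> (\<lambda>i. G (y i)) n) \<le> c * h powr (r - 1) * Linf_time_norm T \<Omega> r (U 1)"
      by (rule norm_D_plus_dominated_samples_le[OF x_dom pos(2) N pos(3) K Z1(1,2,3) g(1,2) n])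
    also have "\<dots> \<le> h powr (r - 1) * A"
      by (intro scaled M(2)) simp
    finally show ?thesis .
  qed
  have "ell2_norm \<tau> 1 (N - 1) (D_plus \<tau> (D_minus \<tau> (\<lambda>i. G (y i)))) \<le> 2 * (c * h powr (r - 1)) * L2_time_norm T \<Omega> r (U 2)"
    using ell2_norm_dominated_second_differences[OF x_dom pos(2) N pos(3) K g] L2_norm[of 2] by simp
  also have "\<dots> \<le> 2 * (c * h powr (r - 1)) * ?M"
    using M(1)[of 2] K by (intro mult_left_mono) auto
  also have "\<dots> = h powr (r - 1) * (2 * (c * ?M))"
    by (simp only: mult_ac)
  also have "\<dots> \<le> h powr (r - 1) * A"
    using A(2) by (intro mult_left_mono) auto
  finally show "ell2_norm \<tau> 1 (N - 1) (D_plus \<tau> (D_minus \<tau> (\<lambda>i. G (y i)))) \<le> h powr (r - 1) * A" .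
qed

section \<open>Test sequences and the dual norm\<close>

lemma linear_on_M_tau:
  assumes \<V>: "subspace \<V>"
    and add: "\<And>u v. u \<in> \<V> \<Longrightarrow> v \<in> \<V> \<Longrightarrow> G (u + v) = G u + G v"
    and scale: "\<And>u c. u \<in> \<V> \<Longrightarrow> G (c *\<^sub>R u) = c *\<^sub>R G u"
    and V: "\<And>i. i \<le> n \<Longrightarrow> V i \<in> \<V>"
  shows "M_tau b l V n \<in> \<V>" "G (M_tau b l V n) = M_tau b l (\<lambda>i. G (V i)) n"
proof -
  have "(\<Sum>j\<le>l. b j *\<^sub>R V (n - j)) \<in> \<V> \<and>
      G (\<Sum>j\<le>l. b j *\<^sub>R V (n - j)) = (\<Sum>j\<le>l. b j *\<^sub>R G (V (n - j)))"
    by (induction l) (use \<V> V add scale in \<open>auto simp: subspace_add subspace_scale\<close>)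
  then show "M_tau b l V n \<in> \<V>" "G (M_tau b l V n) = M_tau b l (\<lambda>i. G (V i)) n"
    by (auto simp: M_tau_def)
qed

lemma linear_on_D_minus:
  assumes \<V>: "subspace \<V>"
    and add: "\<And>u v. u \<in> \<V> \<Longrightarrow> v \<in> \<V> \<Longrightarrow> G (u + v) = G u + G v"
    and scale: "\<And>u c. u \<in> \<V> \<Longrightarrow> G (c *\<^sub>R u) = c *\<^sub>R G u"
    and V: "V n \<in> \<V>" "V (n - 1) \<in> \<V>"
  shows "D_minus \<tau> V n \<in> \<V>" "G (D_minus \<tau> V n) = D_minus \<tau> (\<lambda>i. G (V i)) n"
proof -
  have "G (V n - V (n - 1)) = G (V n) - G (V (n - 1))"
    using add[of "V n" "(-1) *\<^sub>R V (n - 1)"] scale[of "V (n - 1)" "-1"] V subspace_scale[OF \<V> V(2), of "-1"]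
    by simp
  then show "D_minus \<tau> V n \<in> \<V>" "G (D_minus \<tau> V n) = D_minus \<tau> (\<lambda>i. G (V i)) n"
    using V \<V> scale by (auto simp: D_minus_def subspace_scale subspace_diff)
qed

lemma dual_norm_leI:
  assumes "n0 \<le> N"
    and "\<And>m V. m \<in> {n0..N} \<Longrightarrow> range V \<subseteq> Vh \<Longrightarrow>
      0 < initial_energy G \<delta> n0 V + energy_norm_sq \<tau> n0 e d m V \<Longrightarrow>
      \<tau> * (\<Sum>n=n0..m. inner (R n) (P_delta G b l \<tau> \<delta> V n))
        \<le> C * sqrt (initial_energy G \<delta> n0 V + energy_norm_sq \<tau> n0 e d m V)"
  shows "dual_norm Vh G b l \<tau> \<delta> n0 N e d R \<le> ereal C"
  unfolding dual_norm_def
proof (rule Max.boundedI)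
  show "finite ((\<lambda>m. SUP V \<in> {V. range V \<subseteq> Vh \<and> (\<forall>n>m. V n = 0) \<and>
      0 < initial_energy G \<delta> n0 V + energy_norm_sq \<tau> n0 e d m V}.
    ereal ((\<tau> * (\<Sum>n=n0..m. inner (R n) (P_delta G b l \<tau> \<delta> V n))) /
      sqrt (initial_energy G \<delta> n0 V + energy_norm_sq \<tau> n0 e d m V))) ` {n0..N})"
    by simp
qed (use assms in \<open>auto intro!: SUP_least simp: pos_divide_le_eq\<close>)

text \<open>For the initial indices the term \<open>T\<^sub>\<delta> V\<close> is part of the initial energy, for the others it is
controlled by coercivity; the constant \<open>1 + 1 / cE\<close> covers both cases.\<close>

lemma test_sequence_bounds:
  assumes coercive: "coercive_energy Vh G b l \<tau> \<delta> n0 N cE e d"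
    and pos: "0 < cE" "0 < \<tau>" "0 < \<delta>" and m: "m \<in> {n0..N}" and V: "range V \<subseteq> Vh"
    and Q: "Q = initial_energy G \<delta> n0 V + energy_norm_sq \<tau> n0 e d m V"
  shows "\<And>j. j \<le> m \<Longrightarrow> norm (T_delta G \<delta> (V j)) \<le> sqrt (1 + 1 / cE) * sqrt Q"
    and "sqrt \<delta> * ell2_norm \<tau> n0 m (A_tau G b l \<tau> V) \<le> sqrt (1 + 1 / cE) * sqrt Q"
proof -
  define E where "E = Max ((\<lambda>j. e j V) ` {n0..m})"
  have energy: "0 \<le> e n V" "0 \<le> d n V" "cE * (norm (T_delta G \<delta> (V n)))\<^sup>2 \<le> e n V"
    "cE * \<delta> * (norm (A_tau G b l \<tau> V n))\<^sup>2 \<le> d n V" if "n \<in> {n0..m}" for n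
  proof -
    have "n \<in> {n0..N}" using that m by auto
    then show "0 \<le> e n V" "0 \<le> d n V" "cE * (norm (T_delta G \<delta> (V n)))\<^sup>2 \<le> e n V"
      "cE * \<delta> * (norm (A_tau G b l \<tau> V n))\<^sup>2 \<le> d n V"
      using coercive V unfolding coercive_energy_def by blast+
  qed
  have e_le: "e n V \<le> E" if "n \<in> {n0..m}" for n
    unfolding E_def using that by (intro Max_ge) auto
  have E: "0 \<le> E"
    using e_le[of n0] energy(1)[of n0] m by fastforce
  have I: "0 \<le> initial_energy G \<delta> n0 V"
    by (simp add: initial_energy_def sum_nonneg)
  have d: "0 \<le> \<tau> * (\<Sum>n=n0..m. d n V)"
    using pos energy(2) by (intro mult_nonneg_nonneg sum_nonneg) auto
  have Q': "Q = initial_energy G \<delta> n0 V + (E + \<tau> * (\<Sum>n=n0..m. d n V))"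
    by (simp add: Q energy_norm_sq_def E_def)
  have Q0: "0 \<le> Q"
    using I E d Q' by linarith
  have scale: "x \<le> (1 + 1 / cE) * Q" if "x \<le> Q \<or> cE * x \<le> Q" for x
  proof -
    have "x \<le> Q \<or> x \<le> Q / cE"
      using that pos(1) by (simp add: pos_le_divide_eq mult.commute)
    then show ?thesis
      using Q0 pos(1) by (auto simp: algebra_simps add_increasing add_increasing2)
  qed
  show "norm (T_delta G \<delta> (V j)) \<le> sqrt (1 + 1 / cE) * sqrt Q" if j: "j \<le> m" for j
  proof -
    have "(norm (T_delta G \<delta> (V j)))\<^sup>2 \<le> (1 + 1 / cE) * Q"
    proof (rule scale, cases "j < n0")
      case True
      then have "(norm (T_delta G \<delta> (V j)))\<^sup>2 \<le> initial_energy G \<delta> n0 V"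
        unfolding initial_energy_def by (intro member_le_sum) auto
      then show "(norm (T_delta G \<delta> (V j)))\<^sup>2 \<le> Q \<or> cE * (norm (T_delta G \<delta> (V j)))\<^sup>2 \<le> Q"
        using E d Q' by linarith
    next
      case False
      then show "(norm (T_delta G \<delta> (V j)))\<^sup>2 \<le> Q \<or> cE * (norm (T_delta G \<delta> (V j)))\<^sup>2 \<le> Q"
        using energy(3)[of j] e_le[of j] I d Q' j by fastforce
    qed
    then show ?thesis
      by (simp add: real_le_rsqrt flip: real_sqrt_mult)
  qed
  have "cE * (\<delta> * (\<tau> * (\<Sum>n=n0..m. (norm (A_tau G b l \<tau> V n))\<^sup>2)))
      = \<tau> * (\<Sum>n=n0..m. cE * \<delta> * (norm (A_tau G b l \<tau> V n))\<^sup>2)"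
    by (simp add: sum_distrib_left mult_ac)
  also have "\<dots> \<le> \<tau> * (\<Sum>n=n0..m. d n V)"
    using pos energy(4) by (intro mult_left_mono sum_mono) auto
  also have "\<dots> \<le> Q"
    using E I Q' by linarith
  finally have "\<delta> * (\<tau> * (\<Sum>n=n0..m. (norm (A_tau G b l \<tau> V n))\<^sup>2)) \<le> (1 + 1 / cE) * Q"
    by (intro scale) simp
  then show "sqrt \<delta> * ell2_norm \<tau> n0 m (A_tau G b l \<tau> V) \<le> sqrt (1 + 1 / cE) * sqrt Q"
    by (simp add: ell2_norm_def flip: real_sqrt_mult)
qed

text \<open>Pythagoras for the orthogonal vectors \<open>v\<close> and \<open>\<delta> G v\<close>.\<close>

lemma norm_le_norm_T_delta:
  fixes v :: "'a::real_inner"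
  assumes "inner v (G v) = 0" "0 \<le> \<delta>"
  shows "norm v \<le> norm (T_delta G \<delta> v)" "\<delta> * norm (G v) \<le> norm (T_delta G \<delta> v)"
proof -
  have eq: "(norm (T_delta G \<delta> v))\<^sup>2 = (norm v)\<^sup>2 + (\<delta> * norm (G v))\<^sup>2"
    using assms(1) unfolding T_delta_def power2_norm_eq_inner power_mult_distrib
    by (simp add: inner_add_left inner_add_right inner_commute power2_eq_square)
  show "norm v \<le> norm (T_delta G \<delta> v)" "\<delta> * norm (G v) \<le> norm (T_delta G \<delta> v)"
    by (rule power2_le_imp_le; simp add: eq)+
qed

text \<open>The two forms of \<open>P\<^sub>\<delta> V\<close>: one for the pairing with the projection error, one for the residual.\<close>

lemma P_delta_expansions:
  fixes G :: "'a::real_vector \<Rightarrow> 'a" and V :: "nat \<Rightarrow> 'a" and b :: "nat \<Rightarrow> real" and \<delta> \<tau> :: real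
  assumes \<V>: "subspace \<V>"
    and add: "\<And>u v. u \<in> \<V> \<Longrightarrow> v \<in> \<V> \<Longrightarrow> G (u + v) = G u + G v"
    and scale: "\<And>u c. u \<in> \<V> \<Longrightarrow> G (c *\<^sub>R u) = c *\<^sub>R G u"
    and V: "\<And>i. V i \<in> \<V>"
  defines "g \<equiv> \<lambda>i. G (V i)" and "t \<equiv> \<lambda>i. T_delta G \<delta> (V i)"
  shows "A_tau G b l \<tau> V = (\<lambda>n. D_minus \<tau> V n + M_tau b l g n)"
    and "P_delta G b l \<tau> \<delta> V n = M_tau b l V n + \<delta> *\<^sub>R A_tau G b l \<tau> V n + \<delta>\<^sup>2 *\<^sub>R D_minus \<tau> g n"
    and "P_delta G b l \<tau> \<delta> V n = M_tau b l t n + \<delta> *\<^sub>R D_minus \<tau> t n"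
proof -
  have M: "M_tau b l V n \<in> \<V>" "G (M_tau b l V n) = M_tau b l g n" for n
    using linear_on_M_tau[OF \<V> add scale V] by (simp_all add: g_def)
  have D: "D_minus \<tau> V n \<in> \<V>" "G (D_minus \<tau> V n) = D_minus \<tau> g n" for n
    using linear_on_D_minus[OF \<V> add scale V V] by (simp_all add: g_def)
  show A: "A_tau G b l \<tau> V = (\<lambda>n. D_minus \<tau> V n + M_tau b l g n)"
    by (simp add: A_tau_def fun_eq_iff M(2))
  have P: "P_delta G b l \<tau> \<delta> V n
      = M_tau b l V n + \<delta> *\<^sub>R D_minus \<tau> V n + \<delta> *\<^sub>R (M_tau b l g n + \<delta> *\<^sub>R D_minus \<tau> g n)"
    by (simp add: P_delta_def T_delta_def S_delta_def add scale M D subspace_scale[OF \<V>])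
  then show "P_delta G b l \<tau> \<delta> V n = M_tau b l V n + \<delta> *\<^sub>R A_tau G b l \<tau> V n + \<delta>\<^sup>2 *\<^sub>R D_minus \<tau> g n"
    by (simp add: A scaleR_add_right power2_eq_square)
  have "M_tau b l t n = M_tau b l V n + \<delta> *\<^sub>R M_tau b l g n"
    unfolding t_def T_delta_def M_tau_add M_tau_scaleR g_def ..
  moreover have "D_minus \<tau> t n = D_minus \<tau> V n + \<delta> *\<^sub>R D_minus \<tau> g n"
    by (simp add: t_def T_delta_def D_minus_def g_def algebra_simps)
  ultimately show "P_delta G b l \<tau> \<delta> V n = M_tau b l t n + \<delta> *\<^sub>R D_minus \<tau> t n"
    unfolding P by (simp add: scaleR_add_right)
qed

section \<open>The consistency estimate\<close>

theorem proposition3p1: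
  fixes b :: "nat \<Rightarrow> real" and l n0 \<nu> k :: nat
    and s r \<sigma> cE c_app c_ord c_max c_diff \<tau>max :: real
  assumes "l \<le> n0" and "1 \<le> n0" and "1 \<le> s" and "r = min s (real k + 1)"
    and "0 < cE" and "0 < c_app" and "0 < c_ord" and "0 < c_max" and "0 < c_diff"
  shows "\<exists>C>0. \<forall>(\<Omega> :: (real^'d) set) (\<V> :: ('d, 'm::finite) L2 set) G T F U0 U Creg Csharp
           h Vh \<tau> N \<delta> e d \<rho> \<eta>.
    skew_system \<Omega> \<V> G \<and>
    0 < T \<and> exact_solution \<Omega> \<V> G T r F U0 U \<and>
    Creg T (\<nu> + 1) (U 0) F \<le> Csharp T (\<nu> + 2) (U 0) F \<and>
    fe_space \<Omega> \<V> \<sigma> k h Vh \<and>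
    time_grid \<tau>max T \<tau> n0 N \<and>
    0 < \<delta> \<and> \<delta> \<le> 1 \<and>
    \<rho> = residual G b l \<tau> (U 0) F \<and>
    \<eta> = (\<lambda>n. U 0 (real n * \<tau>) - L2_projection Vh (U 0 (real n * \<tau>))) \<and>
    coercive_energy Vh G b l \<tau> \<delta> n0 N cE e d \<and>
    (\<forall>j\<le>2. AE t in lebesgue_on {0<..<T}.
       approximation_estimate Vh G c_app h r (sobolev_norm \<Omega> r) (U j t)) \<and>
    ell2_norm \<tau> n0 N \<rho> \<le> c_ord * \<tau> ^ \<nu> * Creg T (\<nu> + 1) (U 0) F \<and>
    (\<forall>n\<in>{n0..N}. norm (\<rho> n) \<le> c_max * \<tau> ^ \<nu> * Csharp T (\<nu> + 2) (U 0) F) \<and>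
    ell2_norm \<tau> n0 (N - 1) (D_plus \<tau> \<rho>) \<le> c_diff * \<tau> ^ \<nu> * Csharp T (\<nu> + 2) (U 0) F
    \<longrightarrow>
    dual_norm Vh G b l \<tau> \<delta> n0 N e d (\<lambda>n. A_tau G b l \<tau> \<eta> n - \<rho> n)
      \<le> ereal (C * (((1 + sqrt T) * sqrt \<delta> * h powr (r - 1) + h powr r / sqrt \<delta>) * N_norm T \<Omega> r U
                 + (1 + sqrt T) * \<tau> ^ \<nu> * Csharp T (\<nu> + 2) (U 0) F))"
proof -
  define \<beta> where "\<beta> = (\<Sum>j\<le>l. \<bar>b j\<bar>)"
  define cA where "cA = 2 * (1 + \<bar>\<tau>max\<bar>) * c_app"
  define c\<rho> where "c\<rho> = c_ord + c_max + c_diff"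
  \<comment> \<open>\<open>cA\<close> belongs to the projection error, \<open>c\<rho>\<close> to the residual, the root to the bounds for the test sequence\<close>
  define C where "C = (2 + 3 * \<beta>) * (cA + c\<rho>) * sqrt (1 + 1 / cE)"
  have \<beta>: "0 \<le> \<beta>" and cA: "0 < cA" and c\<rho>: "0 < c\<rho>"
    unfolding \<beta>_def cA_def c\<rho>_def using assms(5-9) by (auto intro!: sum_nonneg mult_pos_pos add_pos_nonneg)
  have c\<rho>_ge: "c_ord \<le> c\<rho>" "c_max \<le> c\<rho>" "c_diff \<le> c\<rho>"
    unfolding c\<rho>_def using assms(7-9) by auto
  have cE: "0 < sqrt (1 + 1 / cE)"
    using assms(5) by (simp add: add_pos_pos)
  have C: "0 < C"
    unfolding C_def using \<beta> cA c\<rho> cE by (intro mult_pos_pos) auto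
  have bound: "dual_norm Vh G b l \<tau> \<delta> n0 N e d (\<lambda>n. A_tau G b l \<tau> \<eta> n - \<rho> n)
      \<le> ereal (C * (((1 + sqrt T) * sqrt \<delta> * h powr (r - 1) + h powr r / sqrt \<delta>) * N_norm T \<Omega> r U
                 + (1 + sqrt T) * \<tau> ^ \<nu> * S))"
    if system: "skew_system \<Omega> \<V> G" and T: "0 < T" and exact: "exact_solution \<Omega> \<V> G T r F U0 U"
      and S: "R \<le> S" and fe: "fe_space \<Omega> \<V> \<sigma> k h Vh" and grid: "time_grid \<tau>max T \<tau> n0 N"
      and \<delta>: "0 < \<delta>" "\<delta> \<le> 1"
      and \<eta>: "\<eta> = (\<lambda>n. U 0 (real n * \<tau>) - L2_projection Vh (U 0 (real n * \<tau>)))"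
      and coercive: "coercive_energy Vh G b l \<tau> \<delta> n0 N cE e d"
      and appr: "\<forall>j\<le>2. AE t in lebesgue_on {0<..<T}.
        approximation_estimate Vh G c_app h r (sobolev_norm \<Omega> r) (U j t)"
      and ell2_\<rho>: "ell2_norm \<tau> n0 N \<rho> \<le> c_ord * \<tau> ^ \<nu> * R"
      and max_\<rho>: "\<forall>n\<in>{n0..N}. norm (\<rho> n) \<le> c_max * \<tau> ^ \<nu> * S"
      and diff_\<rho>: "ell2_norm \<tau> n0 (N - 1) (D_plus \<tau> \<rho>) \<le> c_diff * \<tau> ^ \<nu> * S"
    for \<Omega> :: "(real^'d) set" and \<V> Vh :: "('d, 'm) L2 set" and G T F U0 U R S h \<tau> N \<delta> e d \<rho> \<eta>
  proof (rule dual_norm_leI)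
    have \<tau>: "0 < \<tau>" "\<tau> \<le> \<tau>max" "n0 \<le> N" "real N * \<tau> \<le> T"
      using grid by (simp_all add: time_grid_def)
    then show "n0 \<le> N" by simp
    have N: "1 \<le> N" using \<tau>(3) assms(2) by simp
    obtain \<T> B where mesh: "shape_regular_mesh \<sigma> \<Omega> h \<T>" and Vh: "Vh = span B" "finite B" "Vh \<subseteq> \<V>"
      using fe unfolding fe_space_def by metis
    note skew = skew_systemD[OF system]
    have h: "0 < h"
      using mesh skew(1) by (rule mesh_size_pos)
    let ?A = "cA * N_norm T \<Omega> r U"
    define P where "P = c\<rho> * \<tau> ^ \<nu> * S"
    have P_le: "ell2_norm \<tau> n0 N \<rho> \<le> P" "\<And>n. n0 \<le> n \<Longrightarrow> n \<le> N \<Longrightarrow> norm (\<rho> n) \<le> P"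
      "ell2_norm \<tau> n0 (N - 1) (D_plus \<tau> \<rho>) \<le> P" "0 \<le> \<tau> ^ \<nu> * S"
    proof -
      have "0 \<le> c_max * (\<tau> ^ \<nu> * S)"
        using order_trans[OF norm_ge_zero bspec[OF max_\<rho>, of n0]] \<tau>(3) by (simp add: mult.assoc)
      then show 0: "0 \<le> \<tau> ^ \<nu> * S"
        using assms(8) by (simp add: zero_le_mult_iff)
      have le: "a * \<tau> ^ \<nu> * S \<le> P" if "a \<le> c\<rho>" for a
        unfolding P_def mult.assoc using 0 that by (rule mult_right_mono[rotated])
      have "c_ord * \<tau> ^ \<nu> * R \<le> c_ord * \<tau> ^ \<nu> * S"
        using S assms(7) \<tau>(1) by (intro mult_left_mono) auto
      with ell2_\<rho> show "ell2_norm \<tau> n0 N \<rho> \<le> P"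
        using le[of c_ord] c\<rho>_ge(1) by linarith
      show "norm (\<rho> n) \<le> P" if "n0 \<le> n" "n \<le> N" for n
        using bspec[OF max_\<rho>, of n] that le[OF c\<rho>_ge(2)] by simp
      show "ell2_norm \<tau> n0 (N - 1) (D_plus \<tau> \<rho>) \<le> P"
        using diff_\<rho> le[OF c\<rho>_ge(3)] by linarith
    qed
    define x where "x = (\<lambda>i. G (\<eta> i))"
    have \<eta>_in: "\<eta> i \<in> \<V>" if "i \<le> N" for i
      using exact grid_point_in_time_interval[OF that \<tau>(1,4)] projection_error_in[OF skew(2) Vh]
      unfolding \<eta> exact_solution_def by blast
    have A_\<eta>: "A_tau G b l \<tau> \<eta> n = D_minus \<tau> \<eta> n + M_tau b l x n" if "n \<le> N" for n
        unfolding A_tau_def x_def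
      by (subst linear_on_M_tau(2)[OF skew(2)]) (fact skew(4), fact skew(5), use that in \<open>auto intro: \<eta>_in\<close>)
    have orth: "inner (\<eta> i) v = 0" if "v \<in> Vh" for i v
      unfolding \<eta> by (rule L2_projection_orthogonal[OF Vh(1,2) that])
    note sample = projection_error_sample_bounds[OF system exact appr Vh h \<tau>(1,4) T N less_imp_le[OF assms(6)] \<tau>(2) \<eta>,
        folded cA_def x_def]
    fix m and V :: "nat \<Rightarrow> ('d, 'm) L2" assume m: "m \<in> {n0..N}" and V: "range V \<subseteq> Vh"
    define Q where "Q = initial_energy G \<delta> n0 V + energy_norm_sq \<tau> n0 e d m V"
    define \<omega> where "\<omega> = sqrt (1 + 1 / cE) * sqrt Q"
    define g where "g = (\<lambda>i. G (V i))"
    define t where "t = (\<lambda>i. T_delta G \<delta> (V i))"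
    define a where "a = A_tau G b l \<tau> V"
    have V_in: "V i \<in> Vh" "V i \<in> \<V>" for i
      using V Vh(3) by auto
    have a: "a = (\<lambda>n. D_minus \<tau> V n + M_tau b l g n)"
      unfolding a_def g_def by (rule P_delta_expansions[OF skew(2)]) (fact skew(4), fact skew(5), rule V_in(2))
    have P1: "P_delta G b l \<tau> \<delta> V n = M_tau b l V n + \<delta> *\<^sub>R a n + \<delta>\<^sup>2 *\<^sub>R D_minus \<tau> g n" for n
      unfolding a_def g_def by (rule P_delta_expansions[OF skew(2)]) (fact skew(4), fact skew(5), rule V_in(2))
    have P2: "P_delta G b l \<tau> \<delta> V n = M_tau b l t n + \<delta> *\<^sub>R D_minus \<tau> t n" for n
      unfolding t_def by (rule P_delta_expansions[OF skew(2)]) (fact skew(4), fact skew(5), rule V_in(2))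
    have t_le: "norm (t j) \<le> \<omega>" if "j \<le> m" for j
      unfolding t_def \<omega>_def by (rule test_sequence_bounds(1)[OF coercive assms(5) \<tau>(1) \<delta>(1) m V Q_def that])
    have a_le: "sqrt \<delta> * ell2_norm \<tau> n0 m a \<le> \<omega>"
      unfolding a_def \<omega>_def by (rule test_sequence_bounds(2)[OF coercive assms(5) \<tau>(1) \<delta>(1) m V Q_def])
    have V_g: "inner (V i) (g i) = 0" for i
      using skew(7)[OF V_in(2) V_in(2), of i i] by (simp add: g_def inner_commute)
    have V_le: "norm (V j) \<le> \<omega>" "\<delta> * norm (g j) \<le> \<omega>" if "j \<le> m" for j
      using norm_le_norm_T_delta[of "V j" G \<delta>] V_g[of j] t_le[OF that] \<delta>(1)
      unfolding t_def g_def by (auto intro: order_trans)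
    have m': "n0 \<le> m" "m \<le> N" using m by auto
    have "\<tau> * (\<Sum>n=n0..m. inner (D_minus \<tau> \<eta> n + M_tau b l x n)
        (M_tau b l V n + \<delta> *\<^sub>R a n + \<delta>\<^sup>2 *\<^sub>R D_minus \<tau> g n))
      \<le> (2 + 3 * \<beta>) * ((h powr r * ?A) / sqrt \<delta> + sqrt \<delta> * (1 + sqrt T) * (h powr (r - 1) * ?A)) * \<omega>"
    proof (rule projection_error_pairing_le[OF \<tau>(1) \<delta> assms(1,2) m' \<tau>(4) _ _ a V_le a_le])
      show "inner (x i) (V j) = - inner (\<eta> i) (g j)" if "i \<le> N" for i j
        unfolding x_def g_def by (rule skew(7)[OF \<eta>_in[OF that] V_in(2)])
    qed (use sample orth V_in \<beta>_def in \<open>auto simp: fun_cong[OF x_def]\<close>)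
    moreover have "\<bar>\<tau> * (\<Sum>n=n0..m. inner (\<rho> n) (M_tau b l t n + \<delta> *\<^sub>R D_minus \<tau> t n))\<bar>
        \<le> (2 + \<beta>) * ((1 + sqrt T) * P) * \<omega>"
      by (rule residual_pairing_le[OF \<tau>(1) \<delta> assms(2) m' \<tau>(4) t_le P_le(1-3) \<beta>_def])
    moreover have "\<tau> * (\<Sum>n=n0..m. inner (A_tau G b l \<tau> \<eta> n - \<rho> n) (P_delta G b l \<tau> \<delta> V n))
      = \<tau> * (\<Sum>n=n0..m. inner (D_minus \<tau> \<eta> n + M_tau b l x n)
          (M_tau b l V n + \<delta> *\<^sub>R a n + \<delta>\<^sup>2 *\<^sub>R D_minus \<tau> g n))
        - \<tau> * (\<Sum>n=n0..m. inner (\<rho> n) (M_tau b l t n + \<delta> *\<^sub>R D_minus \<tau> t n))"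
    proof -
      have "inner (A_tau G b l \<tau> \<eta> n - \<rho> n) (P_delta G b l \<tau> \<delta> V n)
        = inner (D_minus \<tau> \<eta> n + M_tau b l x n) (M_tau b l V n + \<delta> *\<^sub>R a n + \<delta>\<^sup>2 *\<^sub>R D_minus \<tau> g n)
          - inner (\<rho> n) (M_tau b l t n + \<delta> *\<^sub>R D_minus \<tau> t n)" if "n \<in> {n0..m}" for n
        using that m' A_\<eta>[of n] by (simp only: inner_diff_left P1[symmetric] P2[symmetric]) (simp add: inner_diff_left)
      then show ?thesis
        by (simp add: sum_subtractf right_diff_distrib)
    qed
    ultimately have "\<tau> * (\<Sum>n=n0..m. inner (A_tau G b l \<tau> \<eta> n - \<rho> n) (P_delta G b l \<tau> \<delta> V n))
      \<le> (2 + 3 * \<beta>) * ((h powr r * ?A) / sqrt \<delta> + sqrt \<delta> * (1 + sqrt T) * (h powr (r - 1) * ?A)) * \<omega>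
        + (2 + \<beta>) * ((1 + sqrt T) * P) * \<omega>"
      by linarith
    also have "\<dots> \<le> C * (((1 + sqrt T) * sqrt \<delta> * h powr (r - 1) + h powr r / sqrt \<delta>) * N_norm T \<Omega> r U
        + (1 + sqrt T) * \<tau> ^ \<nu> * S) * sqrt Q"
    proof -
      define X where "X = ((1 + sqrt T) * sqrt \<delta> * h powr (r - 1) + h powr r / sqrt \<delta>) * N_norm T \<Omega> r U"
      define Y where "Y = (1 + sqrt T) * \<tau> ^ \<nu> * S"
      have "0 \<le> L2_time_norm T \<Omega> r (U 0)"
        by (simp add: L2_time_norm_def)
      then have "0 \<le> N_norm T \<Omega> r U"
        using N_norm_bounds(1)[OF exact T, of 0] by simp
      then have X: "0 \<le> X"
        unfolding X_def using T \<delta> by (intro mult_nonneg_nonneg add_nonneg_nonneg divide_nonneg_nonneg) auto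
      have Y: "0 \<le> Y"
        unfolding Y_def using P_le(4) T by (simp add: mult.assoc)
      have \<omega>: "0 \<le> \<omega>"
        using V_le(1)[of 0] norm_ge_zero order_trans by blast
      have "(2 + 3 * \<beta>) * ((h powr r * ?A) / sqrt \<delta> + sqrt \<delta> * (1 + sqrt T) * (h powr (r - 1) * ?A)) * \<omega>
          + (2 + \<beta>) * ((1 + sqrt T) * P) * \<omega> = ((2 + 3 * \<beta>) * cA * X + (2 + \<beta>) * c\<rho> * Y) * \<omega>"
        by (simp add: X_def Y_def P_def algebra_simps add_divide_distrib)
      also have "\<dots> \<le> ((2 + 3 * \<beta>) * (cA + c\<rho>) * X + (2 + 3 * \<beta>) * (cA + c\<rho>) * Y) * \<omega>"
        using \<beta> cA c\<rho> X Y \<omega> by (intro mult_right_mono add_mono mult_mono mult_nonneg_nonneg) auto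
      also have "\<dots> = C * (X + Y) * sqrt Q"
        by (simp add: C_def \<omega>_def algebra_simps)
      finally show ?thesis
        unfolding X_def Y_def .
    qed
    finally show "\<tau> * (\<Sum>n=n0..m. inner (A_tau G b l \<tau> \<eta> n - \<rho> n) (P_delta G b l \<tau> \<delta> V n))
      \<le> C * (((1 + sqrt T) * sqrt \<delta> * h powr (r - 1) + h powr r / sqrt \<delta>) * N_norm T \<Omega> r U
          + (1 + sqrt T) * \<tau> ^ \<nu> * S)
        * sqrt (initial_energy G \<delta> n0 V + energy_norm_sq \<tau> n0 e d m V)"
      unfolding Q_def .
  qed
  show ?thesis
    by (rule exI[of _ C], intro conjI allI impI, rule C, elim conjE, rule bound, assumption+)
qed

end
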